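(* Let $I=(\mathcal{M},\mathcal{J})$ be an instance of the makespan scheduling problem with $m$ machines and $n$ jobs, let $S$ be a schedule, let $D=(D^-,D^+)$ be fixed decisions, let $E\approx S$ be the extension corresponding to $S$, and let $(\mathrm{Args},\rightsquigarrow)$ be, respectively, the feasibility AF $(\mathrm{Args}_F,\rightsquigarrow_F)$, the optimality AF $(\mathrm{Args}_S,\rightsquigarrow_S)$ of $S$, or the fixed decision AF $(\mathrm{Args}_D,\rightsquigarrow_D)$. Then: 1. $S$ is not feasible / is not efficient / violates the fixed decisions $D$, respectively, if and only if either there is an attack $a\rightsquigarrow b$ with $a,b\in E$, or there is a non-attack $E\not\rightsquigarrow b$ with $b\notin E$, that explains why $S$ is not feasible / is not efficient / violates fixed decisions, respectively. 2. Explaining why $S$ is not feasible / is not efficient / violates fixed decisions can be done in $O(n^2m^2)$ time. 3. Each explanation is of size polynomial in the size of $S$.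
   Context: Makespan scheduling. An instance is a pair $(\mathcal{M},\mathcal{J})$ with machines $\mathcal{M}=\{1,\dots,m\}$ and jobs $\mathcal{J}=\{1,\dots,n\}$, $m,n\geq 1$, where each job $j$ has a processing time $p_j\ge 0$. A schedule is a matrix $S=(x_{i,j})\in\{0,1\}^{m\times n}$ ($x_{i,j}=1$ means job $j$ is assigned to machine $i$); no further constraint is imposed on a schedule. For a schedule $S$, $C_i=\sum_{j=1}^n x_{i,j}p_j$ is the completion time of machine $i$ and $C_{\max}=\max_{i}C_i$ is the makespan. $S$ is feasible iff it meets the constraints $C_{\max}\geq C_i$ and $C_i=\sum_{j} x_{i,j}p_j$ for all $i\in\mathcal{M}$, and $\sum_{i=1}^m x_{i,j}=1$ for all $j\in\mathcal{J}$. Efficiency. $S$ satisfies the Single Exchange Property SEP (respectively the Pairwise Exchange Property PEP) iff for every machine $i$ and job $j$ with $x_{i,j}=1$ and $C_i=C_{\max}$, and every machine $i'\neq i$: (SEP) $C_i-C_{i'}\leq p_j$; (PEP) for any job $j'\neq j$ with $x_{i',j'}=1$, if $p_j>p_{j'}$ then $C_i+p_{j'}\leq C_{i'}+p_j$. $S$ is efficient iff $S$ is feasible and satisfies both SEP and PEP. Fixed decisions. Negative fixed decisions are a set $D^-=\mathcal{M}^-\times\mathcal{J}^-\subseteq\mathcal{M}\times\mathcal{J}$; positive fixed decisions are a set $D^+=\mathcal{M}^+\times\mathcal{J}^+\subseteq\mathcal{M}\times\mathcal{J}$; fixed decisions are a pair $D=(D^-,D^+)$ of such sets with $D^-\cap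 D^+=\emptyset$ and such that there are no $(i,j),(k,j)\in D^+$ with $i\neq k$. $S$ satisfies $D$ iff $x_{i,j}=0$ for all $(i,j)\in D^-$ and $x_{i,j}=1$ for all $(i,j)\in D^+$; otherwise $S$ violates $D$. Abstract argumentation. An abstract argumentation framework (AF) is a directed graph $(\mathrm{Args},\rightsquigarrow)$ with a set of arguments and a binary attack relation. An extension is a set $E\subseteq\mathrm{Args}$. $E\rightsquigarrow b$ means $a\rightsquigarrow b$ for some $a\in E$; $b\rightsquigarrow E$ means $b\rightsquigarrow a$ for some $a\in E$; $\not\rightsquigarrow$ denotes the negation. Feasibility AF: $\mathrm{Args}_F=\{a_{i,j}: i\in\mathcal{M}, j\in\mathcal{J}\}$ (pairwise distinct) and $a_{i,j}\rightsquigarrow_F a_{k,l}$ iff $i\neq k$ and $j=l$. Correspondence: $S\approx E$ means that for all $i,j$: $x_{i,j}=1$ iff $a_{i,j}\in E$. Optimality AF of $S$: $\mathrm{Args}_S=\mathrm{Args}_F$ and $$\rightsquigarrow_S\;=\;\bigl(\rightsquigarrow_F\setminus\{(a_{i,j},a_{i',j}): C_i=C_{\max},\,x_{i,j}=1,\,C_i>C_{i'}+p_j\}\bigr)\cup\{(a_{i',j'},a_{i,j}): C_i=C_{\max},\,x_{i,j}=1,\,x_{i',j'}=1,\,i'\neq i,\,j'\neq j,\,p_j>p_{j'},\,C_i+p_{j'}>C_{i'}+p_j\}.$$ Fixed decision AF: $\mathrm{Args}_D=\mathrm{Args}_F$ and $$\rightsquigarrow_D\;=\;\bigl(\rightsquigarrow_F\cup\{(a_{i,j},a_{i,j}):(i,j)\in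 D^-\}\bigr)\setminus\{(a_{k,l},a_{i,j}):(i,j)\in D^+,\,(k,l)\in\mathcal{M}\times\mathcal{J}\}.$$ Explanations via attacks. For $(\mathrm{Args},\rightsquigarrow)$ one of the three AFs above, an attack $a\rightsquigarrow b$ with $a,b\in E$ explains why $S$: is not feasible, when $(a,b)\in\,\rightsquigarrow_F$; is not efficient, when $(a,b)\in\,\rightsquigarrow_S\setminus\rightsquigarrow_F$; violates fixed decisions, when $(a,b)\in\,\rightsquigarrow_D\setminus\rightsquigarrow_F$. Explanations via non-attacks. A non-attack $E\not\rightsquigarrow b$ with $b\notin E$ explains why $S$: is not feasible, when $\rightsquigarrow\,=\,\rightsquigarrow_F$; is not efficient, when $\rightsquigarrow\,=\,\rightsquigarrow_S$ and $b\rightsquigarrow_S E$; violates fixed decisions, when $\rightsquigarrow\,=\,\rightsquigarrow_D$ and $b$ is unattacked (no argument attacks $b$ with respect to $\rightsquigarrow_D$).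
   Formalization: Part 1 as stated fails for some infeasible S; for efficiency it is proved for feasible S (for all S: not efficient iff infeasibility or inefficiency is explained), for fixed decisions when m ≥ 2 or S is feasible (for all S, a violation is explained). *)

theory Defs
  imports Complex_Main "HOL-Library.Log_Nat" "HOL-Computational_Algebra.Polynomial"
begin

section \<open>Makespan scheduling\<close>

record problem =
  num_machines :: nat
  num_jobs :: nat
  ptime :: "nat \<Rightarrow> real"

definition machines :: "problem \<Rightarrow> nat set" where
  "machines I = {1..num_machines I}"

definition jobs :: "problem \<Rightarrow> nat set" where
  "jobs I = {1..num_jobs I}"

definition makespan_instance :: "problem \<Rightarrow> bool" where
  "makespan_instance I \<longleftrightarrow>
     1 \<le> num_machines I \<and> 1 \<le> num_jobs I \<and> (\<forall>j\<in>jobs I. 0 \<le> ptime I j)"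

text \<open>A schedule is a 0-1 matrix; entries outside \<open>machines I \<times> jobs I\<close> are irrelevant.\<close>

type_synonym schedule = "nat \<Rightarrow> nat \<Rightarrow> nat"

definition is_schedule :: "problem \<Rightarrow> schedule \<Rightarrow> bool" where
  "is_schedule I S \<longleftrightarrow> (\<forall>i\<in>machines I. \<forall>j\<in>jobs I. S i j \<in> {0, 1})"

definition completion :: "problem \<Rightarrow> schedule \<Rightarrow> nat \<Rightarrow> real" where
  "completion I S i = (\<Sum>j\<in>jobs I. real (S i j) * ptime I j)"

definition makespan :: "problem \<Rightarrow> schedule \<Rightarrow> real" where
  "makespan I S = Max (completion I S ` machines I)"

text \<open>The first two constraints hold by definition of \<^const>\<open>makespan\<close> and
  \<^const>\<open>completion\<close>; they are listed because they belong to the optimisation model.\<close>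

definition feasible :: "problem \<Rightarrow> schedule \<Rightarrow> bool" where
  "feasible I S \<longleftrightarrow>
     (\<forall>i\<in>machines I. makespan I S \<ge> completion I S i) \<and>
     (\<forall>i\<in>machines I. completion I S i = (\<Sum>j\<in>jobs I. real (S i j) * ptime I j)) \<and>
     (\<forall>j\<in>jobs I. (\<Sum>i\<in>machines I. S i j) = 1)"

definition SEP :: "problem \<Rightarrow> schedule \<Rightarrow> bool" where
  "SEP I S \<longleftrightarrow>
     (\<forall>i\<in>machines I. \<forall>j\<in>jobs I. S i j = 1 \<and> completion I S i = makespan I S \<longrightarrow>
       (\<forall>i'\<in>machines I. i' \<noteq> i \<longrightarrow> completion I S i - completion I S i' \<le> ptime I j))"

definition PEP :: "problem \<Rightarrow> schedule \<Rightarrow> bool" where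
  "PEP I S \<longleftrightarrow>
     (\<forall>i\<in>machines I. \<forall>j\<in>jobs I. S i j = 1 \<and> completion I S i = makespan I S \<longrightarrow>
       (\<forall>i'\<in>machines I. i' \<noteq> i \<longrightarrow>
         (\<forall>j'\<in>jobs I. j' \<noteq> j \<and> S i' j' = 1 \<longrightarrow> ptime I j > ptime I j' \<longrightarrow>
            completion I S i + ptime I j' \<le> completion I S i' + ptime I j)))"

definition efficient :: "problem \<Rightarrow> schedule \<Rightarrow> bool" where
  "efficient I S \<longleftrightarrow> feasible I S \<and> SEP I S \<and> PEP I S"

text \<open>Fixed decisions are a pair (negative, positive).\<close>

type_synonym decisions = "(nat \<times> nat) set \<times> (nat \<times> nat) set"

definition fixed_decisions :: "problem \<Rightarrow> decisions \<Rightarrow> bool" where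
  "fixed_decisions I D \<longleftrightarrow>
     (\<exists>Mn\<subseteq>machines I. \<exists>Jn\<subseteq>jobs I. fst D = Mn \<times> Jn) \<and>
     (\<exists>Mp\<subseteq>machines I. \<exists>Jp\<subseteq>jobs I. snd D = Mp \<times> Jp) \<and>
     fst D \<inter> snd D = {} \<and>
     \<not> (\<exists>i j k. (i, j) \<in> snd D \<and> (k, j) \<in> snd D \<and> i \<noteq> k)"

definition satisfies :: "schedule \<Rightarrow> decisions \<Rightarrow> bool" where
  "satisfies S D \<longleftrightarrow> (\<forall>(i, j)\<in>fst D. S i j = 0) \<and> (\<forall>(i, j)\<in>snd D. S i j = 1)"


section \<open>Argumentation frameworks\<close>

record 'a af =
  args :: "'a set"
  attacks :: "('a \<times> 'a) set"

text \<open>The argument $a_{i,j}$ is represented by the pair \<open>(i, j)\<close>.\<close>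

type_synonym arg = "nat \<times> nat"

definition feasibility_af :: "problem \<Rightarrow> arg af" where
  "feasibility_af I =
    \<lparr>args = machines I \<times> jobs I,
     attacks = {((i, j), (k, l)) | i j k l.
       i \<in> machines I \<and> j \<in> jobs I \<and> k \<in> machines I \<and> l \<in> jobs I \<and> i \<noteq> k \<and> j = l}\<rparr>"

definition optimality_af :: "problem \<Rightarrow> schedule \<Rightarrow> arg af" where
  "optimality_af I S =
    \<lparr>args = args (feasibility_af I),
     attacks =
       (attacks (feasibility_af I) -
         {((i, j), (i', j)) | i j i'.
           i \<in> machines I \<and> j \<in> jobs I \<and> i' \<in> machines I \<and>
           completion I S i = makespan I S \<and> S i j = 1 \<and>
           completion I S i > completion I S i' + ptime I j}) \<union>
       {((i', j'), (i, j)) | i j i' j'.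
           i \<in> machines I \<and> j \<in> jobs I \<and> i' \<in> machines I \<and> j' \<in> jobs I \<and>
           completion I S i = makespan I S \<and> S i j = 1 \<and> S i' j' = 1 \<and>
           i' \<noteq> i \<and> j' \<noteq> j \<and> ptime I j > ptime I j' \<and>
           completion I S i + ptime I j' > completion I S i' + ptime I j}\<rparr>"

definition fixed_decision_af :: "problem \<Rightarrow> decisions \<Rightarrow> arg af" where
  "fixed_decision_af I D =
    \<lparr>args = args (feasibility_af I),
     attacks =
       (attacks (feasibility_af I) \<union> {((i, j), (i, j)) | i j. (i, j) \<in> fst D}) -
       {((k, l), (i, j)) | i j k l. (i, j) \<in> snd D \<and> k \<in> machines I \<and> l \<in> jobs I}\<rparr>"

definition corresponds :: "problem \<Rightarrow> schedule \<Rightarrow> arg set \<Rightarrow> bool" where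
  "corresponds I S E \<longleftrightarrow>
     E \<subseteq> args (feasibility_af I) \<and>
     (\<forall>i\<in>machines I. \<forall>j\<in>jobs I. S i j = 1 \<longleftrightarrow> (i, j) \<in> E)"


section \<open>Explanations\<close>

datatype property = Feasibility | Efficiency | Decisions

text \<open>The way in which a schedule can fail, and the framework used to explain the failure.\<close>

fun fails :: "property \<Rightarrow> problem \<Rightarrow> schedule \<Rightarrow> decisions \<Rightarrow> bool" where
  "fails Feasibility I S D \<longleftrightarrow> \<not> feasible I S"
| "fails Efficiency I S D \<longleftrightarrow> \<not> efficient I S"
| "fails Decisions I S D \<longleftrightarrow> \<not> satisfies S D"

fun framework :: "property \<Rightarrow> problem \<Rightarrow> schedule \<Rightarrow> decisions \<Rightarrow> arg af" where
  "framework Feasibility I S D = feasibility_af I"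
| "framework Efficiency I S D = optimality_af I S"
| "framework Decisions I S D = fixed_decision_af I D"

text \<open>\<open>Attack a b\<close> stands for $a \rightsquigarrow b$, and \<open>NonAttack E b\<close> for
  $E \not\rightsquigarrow b$.\<close>

datatype explanation = Attack arg arg | NonAttack "arg set" arg

text \<open>\<open>explains p F I S D E e\<close>: in the framework \<open>F\<close>, the (non-)attack \<open>e\<close> explains why
  \<open>S\<close>, with corresponding extension \<open>E\<close>, fails \<open>p\<close>.\<close>

fun explains ::
  "property \<Rightarrow> arg af \<Rightarrow> problem \<Rightarrow> schedule \<Rightarrow> decisions \<Rightarrow> arg set \<Rightarrow> explanation \<Rightarrow> bool"
where
  "explains p F I S D E (Attack a b) \<longleftrightarrow>
     a \<in> E \<and> b \<in> E \<and> (a, b) \<in> attacks F \<and>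
     (case p of
        Feasibility \<Rightarrow> (a, b) \<in> attacks (feasibility_af I)
      | Efficiency \<Rightarrow> (a, b) \<in> attacks (optimality_af I S) - attacks (feasibility_af I)
      | Decisions \<Rightarrow> (a, b) \<in> attacks (fixed_decision_af I D) - attacks (feasibility_af I))"
| "explains p F I S D E (NonAttack E' b) \<longleftrightarrow>
     E' = E \<and> b \<in> args F \<and> b \<notin> E \<and> (\<forall>a\<in>E. (a, b) \<notin> attacks F) \<and>
     (case p of
        Feasibility \<Rightarrow> attacks F = attacks (feasibility_af I)
      | Efficiency \<Rightarrow> attacks F = attacks (optimality_af I S) \<and> (\<exists>a\<in>E. (b, a) \<in> attacks F)
      | Decisions \<Rightarrow> attacks F = attacks (fixed_decision_af I D) \<and>
          (\<forall>a\<in>args F. (a, b) \<notin> attacks F))"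

definition explained :: "property \<Rightarrow> problem \<Rightarrow> schedule \<Rightarrow> decisions \<Rightarrow> arg set \<Rightarrow> bool" where
  "explained p I S D E \<longleftrightarrow>
     (\<exists>a b. explains p (framework p I S D) I S D E (Attack a b)) \<or>
     (\<exists>b. explains p (framework p I S D) I S D E (NonAttack E b))"

text \<open>Size in bits: an argument is written as its two indices in binary.\<close>

fun arg_size :: "arg \<Rightarrow> nat" where
  "arg_size (i, j) = floorlog 2 i + floorlog 2 j"

fun explanation_size :: "explanation \<Rightarrow> nat" where
  "explanation_size (Attack a b) = arg_size a + arg_size b"
| "explanation_size (NonAttack E b) = (\<Sum>a\<in>E. arg_size a) + arg_size b"

definition schedule_size :: "problem \<Rightarrow> nat" where
  "schedule_size I = num_machines I * num_jobs I"

text \<open>The equivalence between failing and being explained does not hold without restriction.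
  With one machine and one unassigned job, the schedule is inefficient (it is infeasible), but
  $E = \emptyset$ admits no explanation of inefficiency; and it satisfies the empty fixed
  decisions, although the unattacked argument $a_{1,1} \notin E$ yields an explanation of a
  violation.\<close>

definition tiny :: "problem" where
  "tiny = \<lparr>num_machines = 1, num_jobs = 1, ptime = (\<lambda>_. 1)\<rparr>"

lemma tiny_valid:
  "makespan_instance tiny" "is_schedule tiny (\<lambda>_ _. 0)" "fixed_decisions tiny ({}, {})"
  "corresponds tiny (\<lambda>_ _. 0) {}"
  by (auto simp: makespan_instance_def is_schedule_def fixed_decisions_def corresponds_def
      tiny_def machines_def jobs_def)

lemma inefficient_unexplained:
  "fails Efficiency tiny (\<lambda>_ _. 0) ({}, {})"
  "\<not> explained Efficiency tiny (\<lambda>_ _. 0) ({}, {}) {}"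
  by (auto simp: explained_def efficient_def feasible_def tiny_def machines_def jobs_def)

lemma satisfied_but_explained:
  "\<not> fails Decisions tiny (\<lambda>_ _. 0) ({}, {})"
  "explained Decisions tiny (\<lambda>_ _. 0) ({}, {}) {}"
  by (auto simp: explained_def satisfies_def tiny_def machines_def jobs_def
      fixed_decision_af_def feasibility_af_def)


section \<open>A unit-cost random access machine\<close>

text \<open>The machine has finitely many named arrays per program, of naturals (indices, flags) and of
  reals (processing times); a scalar variable is an array used at index 0 only. Each operator,
  constant, memory access and test costs one unit. Naturals have no multiplication and reals
  only addition, subtraction and comparison, so that unit cost is not abused.\<close>

record state =
  nats :: "string \<Rightarrow> nat \<Rightarrow> nat"
  reals :: "string \<Rightarrow> nat \<Rightarrow> real"

datatype nexp = NConst nat | NGet string nexp | NPlus nexp nexp | NMinus nexp nexp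

datatype rexp = RZero | RGet string nexp | RPlus rexp rexp | RMinus rexp rexp

datatype bexp = NLess nexp nexp | RLess rexp rexp | BNot bexp | BAnd bexp bexp

datatype com =
    Skip
  | NSet string nexp nexp
  | RSet string nexp rexp
  | Seq com com
  | Cond bexp com com
  | While bexp com

fun nval :: "nexp \<Rightarrow> state \<Rightarrow> nat" where
  "nval (NConst c) s = c"
| "nval (NGet x e) s = nats s x (nval e s)"
| "nval (NPlus e f) s = nval e s + nval f s"
| "nval (NMinus e f) s = nval e s - nval f s"

fun rval :: "rexp \<Rightarrow> state \<Rightarrow> real" where
  "rval RZero s = 0"
| "rval (RGet x e) s = reals s x (nval e s)"
| "rval (RPlus e f) s = rval e s + rval f s"
| "rval (RMinus e f) s = rval e s - rval f s"

fun bval :: "bexp \<Rightarrow> state \<Rightarrow> bool" where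
  "bval (NLess e f) s \<longleftrightarrow> nval e s < nval f s"
| "bval (RLess e f) s \<longleftrightarrow> rval e s < rval f s"
| "bval (BNot b) s \<longleftrightarrow> \<not> bval b s"
| "bval (BAnd b c) s \<longleftrightarrow> bval b s \<and> bval c s"

fun ncost :: "nexp \<Rightarrow> nat" where
  "ncost (NConst c) = 1"
| "ncost (NGet x e) = ncost e + 1"
| "ncost (NPlus e f) = ncost e + ncost f + 1"
| "ncost (NMinus e f) = ncost e + ncost f + 1"

fun rcost :: "rexp \<Rightarrow> nat" where
  "rcost RZero = 1"
| "rcost (RGet x e) = ncost e + 1"
| "rcost (RPlus e f) = rcost e + rcost f + 1"
| "rcost (RMinus e f) = rcost e + rcost f + 1"

fun bcost :: "bexp \<Rightarrow> nat" where
  "bcost (NLess e f) = ncost e + ncost f + 1"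
| "bcost (RLess e f) = rcost e + rcost f + 1"
| "bcost (BNot b) = bcost b + 1"
| "bcost (BAnd b c) = bcost b + bcost c + 1"

definition nset :: "string \<Rightarrow> nat \<Rightarrow> nat \<Rightarrow> state \<Rightarrow> state" where
  "nset x k v s = s\<lparr>nats := (nats s)(x := (nats s x)(k := v))\<rparr>"

definition rset :: "string \<Rightarrow> nat \<Rightarrow> real \<Rightarrow> state \<Rightarrow> state" where
  "rset x k v s = s\<lparr>reals := (reals s)(x := (reals s x)(k := v))\<rparr>"

text \<open>\<open>exec c s t s'\<close>: started in \<open>s\<close>, the program \<open>c\<close> halts in \<open>s'\<close> after \<open>t\<close> units of time.\<close>

inductive exec :: "com \<Rightarrow> state \<Rightarrow> nat \<Rightarrow> state \<Rightarrow> bool" where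
  Skip: "exec Skip s 1 s"
| NSet: "exec (NSet x e f) s (ncost e + ncost f + 1) (nset x (nval e s) (nval f s) s)"
| RSet: "exec (RSet x e f) s (ncost e + rcost f + 1) (rset x (nval e s) (rval f s) s)"
| Seq: "exec c s t s' \<Longrightarrow> exec d s' u s'' \<Longrightarrow> exec (Seq c d) s (t + u) s''"
| CondTrue: "bval b s \<Longrightarrow> exec c s t s' \<Longrightarrow> exec (Cond b c d) s (bcost b + t + 1) s'"
| CondFalse: "\<not> bval b s \<Longrightarrow> exec d s t s' \<Longrightarrow> exec (Cond b c d) s (bcost b + t + 1) s'"
| WhileFalse: "\<not> bval b s \<Longrightarrow> exec (While b c) s (bcost b + 1) s"
| WhileTrue: "bval b s \<Longrightarrow> exec c s t s' \<Longrightarrow> exec (While b c) s' u s'' \<Longrightarrow>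
    exec (While b c) s (bcost b + 1 + t + u) s''"

inductive_cases exec_SkipE: "exec Skip s t s'"
inductive_cases exec_NSetE: "exec (NSet x e f) s t s'"
inductive_cases exec_RSetE: "exec (RSet x e f) s t s'"
inductive_cases exec_SeqE: "exec (Seq c d) s t s'"
inductive_cases exec_CondE: "exec (Cond b c d) s t s'"
inductive_cases exec_WhileE: "exec (While b c) s t s'"

lemma exec_deterministic:
  "exec c s t s' \<Longrightarrow> exec c s u s'' \<Longrightarrow> u = t \<and> s'' = s'"
proof (induction arbitrary: u s'' rule: exec.induct)
  case (Seq c s t s1 d v s2)
  from Seq.prems show ?case
    by (rule exec_SeqE) (auto dest: Seq.IH)
next
  case (WhileTrue b s c t s1 v s2)
  from WhileTrue.prems show ?case
    by (rule exec_WhileE) (auto simp: WhileTrue.hyps dest: WhileTrue.IH)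
next
  case (CondTrue b s c t s1 d)
  from CondTrue.prems show ?case
    by (rule exec_CondE) (auto simp: CondTrue.hyps dest: CondTrue.IH)
next
  case (CondFalse b s d t s1 c)
  from CondFalse.prems show ?case
    by (rule exec_CondE) (auto simp: CondFalse.hyps dest: CondFalse.IH)
next
  case (WhileFalse b s c)
  from WhileFalse.prems show ?case
    by (rule exec_WhileE) (auto simp: WhileFalse.hyps)
qed (auto elim: exec_SkipE exec_NSetE exec_RSetE)

text \<open>Input convention. The entry \<open>(i, j)\<close> of an $m \times n$ matrix is kept in cell \<open>i * n + j\<close>;
  these cells are distinct for \<open>1 \<le> j \<le> n\<close>. All other memory cells have arbitrary contents.\<close>

definition is_input :: "problem \<Rightarrow> schedule \<Rightarrow> decisions \<Rightarrow> state \<Rightarrow> bool" where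
  "is_input I S D s \<longleftrightarrow>
     nats s ''m'' 0 = num_machines I \<and> nats s ''n'' 0 = num_jobs I \<and>
     (\<forall>j\<in>jobs I. reals s ''p'' j = ptime I j) \<and>
     (\<forall>i\<in>machines I. \<forall>j\<in>jobs I.
        nats s ''x'' (i * num_jobs I + j) = S i j \<and>
        nats s ''neg'' (i * num_jobs I + j) = of_bool ((i, j) \<in> fst D) \<and>
        nats s ''pos'' (i * num_jobs I + j) = of_bool ((i, j) \<in> snd D))"

text \<open>Output convention. The explanations are listed by attacks, given by the indices of
  attacker and target, and by the unattacked arguments; the set \<open>E\<close> is not repeated.\<close>

definition output_explanations :: "arg set \<Rightarrow> state \<Rightarrow> explanation set" where
  "output_explanations E s =
     {Attack (nats s ''src_i'' k, nats s ''src_j'' k) (nats s ''dst_i'' k, nats s ''dst_j'' k) | k.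
        k < nats s ''attacks'' 0} \<union>
     {NonAttack E (nats s ''non_i'' k, nats s ''non_j'' k) | k. k < nats s ''nonattacks'' 0}"

end

theory Submission
  imports Defs
begin

text \<open>The equivalences follow by unfolding the definitions: two assignments of one job attack each
  other, an argument for an unassigned job is not attacked by \<open>E\<close>, and the two modifications in
  the optimality framework encode exactly the violations of PEP (a new attack inside \<open>E\<close>) and of
  SEP (a deleted attack). For the running time, completion times and makespan are tabulated in
  $O(mn)$; then membership of a pair of arguments in any of the three attack relations is a
  constant-time test, and all $(mn)^2$ pairs are tried. An extension has at most $mn$ arguments,
  each of $O(m + n)$ bits.\<close>

text \<open>The delicate equivalence is the one for SEP. Feasibility gives every job exactly one
  assigned argument, so that among members of \<open>E\<close> only this one can attack a rival of
  the same job; deleting its attack and leaving the rival unattacked by \<open>E\<close> are then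
  the same event. Positive decisions meet a similar obstacle: deleting attacks on an argument is
  visible only if it had an attacker, that is, if there is a second machine. The program lists every
  explanation, not just one. A non-attack quantifies over all potential attackers of a target, so
  targets are enumerated outside and sources inside, with two flags summarising the sources seen;
  \<open>E\<close> is never stored, since membership is read from the matrix. Loop invariants are
  indexed by the set of visited entries, which confines everything about the order of traversal to a
  single loop rule.\<close>

section \<open>Membership in the three attack relations, in terms of indices\<close>

lemma in_attacks_feasibility [simp]:
  "((i, j), (k, l)) \<in> attacks (feasibility_af I) \<longleftrightarrow>
     i \<in> machines I \<and> j \<in> jobs I \<and> k \<in> machines I \<and> l \<in> jobs I \<and> i \<noteq> k \<and> j = l"
  by (auto simp: feasibility_af_def)

lemma in_attacks_optimality [simp]:
  "((i, j), (k, l)) \<in> attacks (optimality_af I S) \<longleftrightarrow>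
     i \<in> machines I \<and> j \<in> jobs I \<and> k \<in> machines I \<and> l \<in> jobs I \<and>
     (i \<noteq> k \<and> j = l \<and>
        \<not> (completion I S i = makespan I S \<and> S i j = 1 \<and>
           completion I S i > completion I S k + ptime I j) \<or>
      completion I S k = makespan I S \<and> S k l = 1 \<and> S i j = 1 \<and> i \<noteq> k \<and> j \<noteq> l \<and>
        ptime I l > ptime I j \<and> completion I S k + ptime I j > completion I S i + ptime I l)"
  by (auto simp: optimality_af_def)

text \<open>The hypothesis keeps \<open>fst D\<close> inside the matrix, so every added self-attack
  has legitimate indices. Deletion depends on the target alone.\<close>

lemma in_attacks_fixed_decision:
  assumes "fixed_decisions I D"
  shows "((i, j), (k, l)) \<in> attacks (fixed_decision_af I D) \<longleftrightarrow>
     i \<in> machines I \<and> j \<in> jobs I \<and> k \<in> machines I \<and> l \<in> jobs I \<and>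
     (i \<noteq> k \<and> j = l \<or> i = k \<and> j = l \<and> (i, j) \<in> fst D) \<and> (k, l) \<notin> snd D"
  using assms by (auto simp: fixed_decision_af_def fixed_decisions_def)

lemma args_simps [simp]:
  "args (feasibility_af I) = machines I \<times> jobs I"
  "args (optimality_af I S) = machines I \<times> jobs I"
  "args (fixed_decision_af I D) = machines I \<times> jobs I"
  "args (framework p I S D) = machines I \<times> jobs I"
  by (cases p; simp add: feasibility_af_def optimality_af_def fixed_decision_af_def)+

lemma finite_machines [simp]: "finite (machines I)"
  and finite_jobs [simp]: "finite (jobs I)"
  by (simp_all add: machines_def jobs_def)

lemma corresponds_iff:
  assumes "corresponds I S E"
  shows "(i, j) \<in> E \<longleftrightarrow> i \<in> machines I \<and> j \<in> jobs I \<and> S i j = 1"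
  using assms by (auto simp: corresponds_def)

lemma ball_corresponds:
  assumes "corresponds I S E"
  shows "(\<forall>a\<in>E. P a) \<longleftrightarrow> (\<forall>i\<in>machines I. \<forall>j\<in>jobs I. S i j = 1 \<longrightarrow> P (i, j))"
  by (auto simp: corresponds_iff[OF assms])


section \<open>Failures and explanations\<close>

text \<open>For 0-1 entries a column sum counts the machines holding the job; the constraints on
  makespan and completion times hold by definition.\<close>

lemma feasible_iff:
  assumes "is_schedule I S"
  shows "feasible I S \<longleftrightarrow> (\<forall>j\<in>jobs I. \<exists>!i. i \<in> machines I \<and> S i j = 1)"
proof -
  have "(\<Sum>i\<in>machines I. S i j) = 1 \<longleftrightarrow> (\<exists>!i. i \<in> machines I \<and> S i j = 1)"
    if j: "j \<in> jobs I" for j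
  proof -
    have "(\<Sum>i\<in>machines I. S i j) = (\<Sum>i\<in>machines I. if S i j = 1 then 1 else 0)"
      using assms j by (intro sum.cong) (auto simp: is_schedule_def)
    also have "\<dots> = card {i \<in> machines I. S i j = 1}"
      by (simp add: sum.If_cases Int_def)
    finally show ?thesis
      by (auto simp: card_1_singleton_iff set_eq_iff) metis+
  qed
  then show ?thesis
    by (simp add: feasible_def makespan_def completion_def)
qed

context
  fixes I :: problem and S :: schedule and D :: decisions and E :: "arg set"
  assumes inst: "makespan_instance I"
    and sched: "is_schedule I S"
    and decs: "fixed_decisions I D"
    and corr: "corresponds I S E"
begin

lemma infeasible_iff_explained: "fails Feasibility I S D \<longleftrightarrow> explained Feasibility I S D E"
proof -
  let ?F = "framework Feasibility I S D"
  have attack: "(\<exists>a b. explains Feasibility ?F I S D E (Attack a b)) \<longleftrightarrow>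
      (\<exists>j\<in>jobs I. \<exists>i\<in>machines I. \<exists>k\<in>machines I. i \<noteq> k \<and> S i j = 1 \<and> S k j = 1)"
    by (auto simp: corresponds_iff[OF corr])
  \<comment> \<open>The right side says that column \<open>j\<close> contains no 1: row
    \<open>k\<close> is excluded directly, and a 1 in any other row would attack
    \<open>(k, j)\<close>.\<close>
  have "explains Feasibility ?F I S D E (NonAttack E (k, j)) \<longleftrightarrow> k \<in> machines I \<and> j \<in> jobs I \<and>
      S k j \<noteq> 1 \<and> (\<forall>i\<in>machines I. S i j = 1 \<longrightarrow> i = k)" for k j
    by (auto simp: corresponds_iff[OF corr] ball_corresponds[OF corr])
  then have nonattack: "(\<exists>b. explains Feasibility ?F I S D E (NonAttack E b)) \<longleftrightarrow>
      (\<exists>j\<in>jobs I. \<exists>k\<in>machines I. S k j \<noteq> 1 \<and> (\<forall>i\<in>machines I. S i j = 1 \<longrightarrow> i = k))"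
    unfolding split_paired_Ex by blast
  \<comment> \<open>An unassigned job needs at least one machine \<open>k\<close> for an unattacked
    argument \<open>(k, j)\<close> to exist.\<close>
  have "machines I \<noteq> {}"
    using inst by (simp add: makespan_instance_def machines_def)
  then have *: "(\<not> (\<exists>!i. i \<in> machines I \<and> S i j = 1)) =
      ((\<exists>i\<in>machines I. \<exists>k\<in>machines I. i \<noteq> k \<and> S i j = 1 \<and> S k j = 1) \<or>
      (\<exists>k\<in>machines I. S k j \<noteq> 1 \<and> (\<forall>i\<in>machines I. S i j = 1 \<longrightarrow> i = k)))" for j
    by blast
  have "fails Feasibility I S D \<longleftrightarrow> (\<exists>j\<in>jobs I. \<not> (\<exists>!i. i \<in> machines I \<and> S i j = 1))"
    unfolding fails.simps feasible_iff[OF sched] by blast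
  then show ?thesis
    unfolding * bex_disj_distrib explained_def attack nonattack .
qed

text \<open>Explaining attacks are the added ones and match failures of PEP; explaining non-attacks
  come from deleted attacks and match failures of SEP. Uniqueness of the assigned machine serves one
  direction for SEP, existence the other.\<close>

lemma inefficient_iff_explained:
  assumes feas: "feasible I S"
  shows "fails Efficiency I S D \<longleftrightarrow> explained Efficiency I S D E"
proof -
  have unique: "i = k"
    if "j \<in> jobs I" "i \<in> machines I" "k \<in> machines I" "S i j = 1" "S k j = 1" for i j k
    using feas that unfolding feasible_iff[OF sched] by blast
  have assigned: "\<exists>i\<in>machines I. S i j = 1" if "j \<in> jobs I" for j
    using feas that unfolding feasible_iff[OF sched] by blast
  have "\<not> PEP I S \<longleftrightarrow>
      (\<exists>a b. explains Efficiency (framework Efficiency I S D) I S D E (Attack a b))"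
    by (fastforce simp: PEP_def corresponds_iff[OF corr])
  moreover have "\<not> SEP I S \<longleftrightarrow>
      (\<exists>b. explains Efficiency (framework Efficiency I S D) I S D E (NonAttack E b))"
  proof
    assume "\<not> SEP I S"
    then obtain i j k where *: "i \<in> machines I" "j \<in> jobs I" "k \<in> machines I" "k \<noteq> i"
      "S i j = 1" "completion I S i = makespan I S"
      "completion I S i > completion I S k + ptime I j"
      by (auto simp: SEP_def)
    then have "S k j \<noteq> 1"
      using unique by blast
    \<comment> \<open>Added attacks only hit assigned arguments, and \<open>(k, j)\<close> is not
      assigned. A feasibility attack would have to come from \<open>(i, j)\<close>, the only member
      of \<open>E\<close> with job \<open>j\<close>, and that attack was deleted.\<close>
    have "(a, (k, j)) \<notin> attacks (optimality_af I S)" if "a \<in> E" for a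
    proof -
      obtain i' j' where "a = (i', j')"
        by (cases a)
      with that have a: "a = (i', j')" "i' \<in> machines I" "S i' j' = 1"
        by (simp_all add: corresponds_iff[OF corr])
      then have "i' = i" if "j' = j"
        using that * unique by blast
      with a * \<open>S k j \<noteq> 1\<close> show ?thesis
        by auto
    qed
    \<comment> \<open>Only attacks with an assigned source are deleted, so the reverse attack
      survives and is the required counterattack.\<close>
    moreover have "((k, j), (i, j)) \<in> attacks (optimality_af I S)" "(i, j) \<in> E"
      using * \<open>S k j \<noteq> 1\<close> by (simp_all add: corresponds_iff[OF corr])
    moreover have "(k, j) \<notin> E"
      using \<open>S k j \<noteq> 1\<close> by (simp add: corresponds_iff[OF corr])
    ultimately have "explains Efficiency (framework Efficiency I S D) I S D E (NonAttack E (k, j))"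
      using * by (simp del: in_attacks_optimality) blast
    then show "\<exists>b. explains Efficiency (framework Efficiency I S D) I S D E (NonAttack E b)" ..
  next
    assume "\<exists>b. explains Efficiency (framework Efficiency I S D) I S D E (NonAttack E b)"
    then obtain k j where *: "k \<in> machines I" "j \<in> jobs I" "S k j \<noteq> 1"
      "\<forall>a\<in>E. (a, (k, j)) \<notin> attacks (optimality_af I S)"
      by (auto simp: corresponds_iff[OF corr])
    obtain i where i: "i \<in> machines I" "S i j = 1"
      using assigned * by blast
    with * have "((i, j), (k, j)) \<notin> attacks (optimality_af I S)"
      by (simp add: corresponds_iff[OF corr] del: in_attacks_optimality)
    \<comment> \<open>Since \<open>i \<noteq> k\<close>, the missing attack is a feasibility attack
      that was deleted, and the condition for deletion is a failure of SEP.\<close>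
    with i * have "completion I S i = makespan I S \<and>
        completion I S i > completion I S k + ptime I j"
      by auto
    with i * show "\<not> SEP I S"
      by (force simp: SEP_def)
  qed
  ultimately show ?thesis
    using feas by (auto simp: efficient_def explained_def)
qed

text \<open>An argument assigned against a negative decision attacks itself, and disjointness of the
  two sets protects this self-attack from deletion. An argument missing against a positive decision
  has lost all its attackers.\<close>

lemma violation_explained:
  assumes "fails Decisions I S D"
  shows "explained Decisions I S D E"
proof -
  have sub: "fst D \<subseteq> machines I \<times> jobs I" "snd D \<subseteq> machines I \<times> jobs I"
    and disj: "fst D \<inter> snd D = {}"
    using decs by (auto simp: fixed_decisions_def)
  from assms consider i j where "(i, j) \<in> fst D" "S i j \<noteq> 0"
    | i j where "(i, j) \<in> snd D" "S i j \<noteq> 1"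
    by (auto simp: satisfies_def)
  then show ?thesis
  proof cases
    case 1
    then have "S i j = 1"
      using sched sub by (fastforce simp: is_schedule_def)
    with 1 have "explains Decisions (framework Decisions I S D) I S D E (Attack (i, j) (i, j))"
      using sub disj by (auto simp: in_attacks_fixed_decision[OF decs] corresponds_iff[OF corr])
    then show ?thesis
      by (auto simp: explained_def simp del: explains.simps)
  next
    case 2
    then have "explains Decisions (framework Decisions I S D) I S D E (NonAttack E (i, j))"
      using sub by (auto simp: in_attacks_fixed_decision[OF decs] corresponds_iff[OF corr])
    then show ?thesis
      by (auto simp: explained_def simp del: explains.simps)
  qed
qed

text \<open>On two or more machines every argument has a rival, so that only a positive decision
  leaves it unattacked; on a single machine feasibility puts all arguments into \<^term>\<open>E\<close>.\<close>

lemma explained_violation: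
  assumes "2 \<le> num_machines I \<or> feasible I S"
    and "explained Decisions I S D E"
  shows "fails Decisions I S D"
  using assms(2) unfolding explained_def
proof (elim disjE exE)
  fix a b
  assume "explains Decisions (framework Decisions I S D) I S D E (Attack a b)"
  \<comment> \<open>Outside the feasibility attacks only self-attacks from negative decisions
    remain.\<close>
  then show ?thesis
    by (cases a; cases b)
      (force simp: in_attacks_fixed_decision[OF decs] corresponds_iff[OF corr] satisfies_def)
next
  fix b
  assume "explains Decisions (framework Decisions I S D) I S D E (NonAttack E b)"
  then obtain k j where kj: "k \<in> machines I" "j \<in> jobs I" "S k j \<noteq> 1"
    "\<forall>i\<in>machines I. ((i, j), (k, j)) \<notin> attacks (fixed_decision_af I D)"
    by (cases b) (auto simp: corresponds_iff[OF corr])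
  have "\<exists>i\<in>machines I. i \<noteq> k"
    using assms(1)
  proof
    assume "2 \<le> num_machines I"
    then have "1 \<in> machines I" "2 \<in> machines I"
      by (auto simp: machines_def)
    then show ?thesis
      by (metis one_eq_numeral_iff semiring_norm(85))
  next
    assume "feasible I S"
    \<comment> \<open>The machine that holds \<open>j\<close> is a rival, because \<open>k\<close>
      does not hold it.\<close>
    then show ?thesis
      using kj unfolding feasible_iff[OF sched] by metis
  qed
  with kj have "(k, j) \<in> snd D"
    by (auto simp: in_attacks_fixed_decision[OF decs])
  with kj show ?thesis
    by (auto simp: satisfies_def)
qed

end


section \<open>Size of explanations\<close>

lemma floorlog_le_self: "floorlog 2 x \<le> x"
  by (rule floorlog_leI) simp_all

text \<open>Binary length is bounded crudely by the index itself, and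
  \<open>m + n \<le> 2 * m * n\<close> for positive dimensions; they are positive because
  \<open>a\<close> exists.\<close>

lemma arg_size_le:
  assumes "a \<in> machines I \<times> jobs I"
  shows "arg_size a \<le> 2 * schedule_size I"
proof -
  obtain i j where a: "a = (i, j)"
    by force
  have ij: "1 \<le> i" "i \<le> num_machines I" "1 \<le> j" "j \<le> num_jobs I"
    using assms by (auto simp: a machines_def jobs_def)
  have "arg_size a \<le> num_machines I + num_jobs I"
    using floorlog_le_self[of i] floorlog_le_self[of j] ij by (simp add: a)
  also have "\<dots> \<le> num_machines I * num_jobs I + num_machines I * num_jobs I"
    using ij by (intro add_mono) auto
  finally show ?thesis
    by (simp add: schedule_size_def)
qed

text \<open>An attack has two arguments of size at most \<open>2 * m * n\<close>; a non-attack has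
  at most \<open>m * n\<close> of them in \<open>E\<close> and one more. The bound covers both
  cases.\<close>

lemma explanation_size_le:
  assumes "corresponds I S E" "explains p (framework p I S D) I S D E e"
  shows "explanation_size e \<le> 2 * schedule_size I * schedule_size I + 4 * schedule_size I"
proof (cases e)
  case (Attack a b)
  then have "a \<in> machines I \<times> jobs I" "b \<in> machines I \<times> jobs I"
    using assms by (auto simp: corresponds_def)
  then have "arg_size a \<le> 2 * schedule_size I" "arg_size b \<le> 2 * schedule_size I"
    by (simp_all only: arg_size_le)
  then show ?thesis
    by (simp add: Attack)
next
  case (NonAttack E' b)
  have E': "E' \<subseteq> machines I \<times> jobs I" and b: "b \<in> machines I \<times> jobs I"
    using assms NonAttack by (auto simp: corresponds_def)
  have "card E' \<le> card (machines I \<times> jobs I)"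
    using E' by (intro card_mono) auto
  then have "card E' \<le> schedule_size I"
    by (simp add: schedule_size_def machines_def jobs_def card_cartesian_product)
  moreover have "(\<Sum>a\<in>E'. arg_size a) \<le> card E' * (2 * schedule_size I)"
    using sum_bounded_above[of E' arg_size "2 * schedule_size I"] arg_size_le E' by auto
  ultimately have "(\<Sum>a\<in>E'. arg_size a) \<le> schedule_size I * (2 * schedule_size I)"
    by (meson le_trans mult_le_mono1)
  with arg_size_le[OF b] show ?thesis
    by (simp add: NonAttack)
qed


section \<open>Total correctness with time bounds\<close>

text \<open>By determinism of \<open>exec\<close>, the existential speaks about the only halting
  run.\<close>

definition runs :: "com \<Rightarrow> state \<Rightarrow> nat \<Rightarrow> (state \<Rightarrow> bool) \<Rightarrow> bool" where
  "runs c s T Q \<longleftrightarrow> (\<exists>t s'. exec c s t s' \<and> t \<le> T \<and> Q s')"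

lemma runs_mono:
  assumes "runs c s T Q" "T \<le> T'" "\<And>s'. Q s' \<Longrightarrow> Q' s'"
  shows "runs c s T' Q'"
  using assms unfolding runs_def by (meson le_trans)

lemma runs_Seq:
  assumes "runs c s T P" "\<And>s'. P s' \<Longrightarrow> runs d s' U Q"
  shows "runs (Seq c d) s (T + U) Q"
  using assms unfolding runs_def by (meson Seq add_mono)

text \<open>The measure \<open>f\<close> drops in every pass, hence bounds their number. Each pass
  pays for the body and a successful test; the final summand pays for the failing test.\<close>

lemma runs_While:
  fixes f :: "state \<Rightarrow> nat"
  assumes "P s"
    and step: "\<And>s. P s \<Longrightarrow> bval b s \<Longrightarrow> runs c s T (\<lambda>s'. P s' \<and> f s' < f s)"
  shows "runs (While b c) s (f s * (T + bcost b + 1) + bcost b + 1) (\<lambda>s'. P s' \<and> \<not> bval b s')"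
  using \<open>P s\<close>
proof (induction "f s" arbitrary: s rule: less_induct)
  case less
  let ?k = "T + bcost b + 1"
  show ?case
  proof (cases "bval b s")
    case True
    from step[OF less.prems True] obtain t s1 where
      1: "exec c s t s1" "t \<le> T" "P s1" "f s1 < f s"
      by (auto simp: runs_def)
    from less.hyps[OF 1(4,3)] obtain u s2 where
      2: "exec (While b c) s1 u s2" "u \<le> f s1 * ?k + bcost b + 1" "P s2" "\<not> bval b s2"
      by (auto simp: runs_def)
    have "Suc (f s1) * ?k \<le> f s * ?k"
      using 1(4) by (intro mult_le_mono1) simp
    then have "bcost b + 1 + t + u \<le> f s * ?k + bcost b + 1"
      using 1(2) 2(2) by simp
    with WhileTrue[OF True 1(1) 2(1)] 2(3,4) show ?thesis
      unfolding runs_def by blast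
  next
    case False
    with WhileFalse[OF False, of c] less.prems show ?thesis
      unfolding runs_def by force
  qed
qed

section \<open>Loop-free code: semantics as a function, with a worst-case cost\<close>

fun loop_free :: "com \<Rightarrow> bool" where
  "loop_free (Seq c d) \<longleftrightarrow> loop_free c \<and> loop_free d"
| "loop_free (Cond b c d) \<longleftrightarrow> loop_free c \<and> loop_free d"
| "loop_free (While b c) \<longleftrightarrow> False"
| "loop_free c \<longleftrightarrow> True"

text \<open>Loop-free code always halts, so loop bodies can be verified by rewriting. The
  \<open>While\<close> clauses here and in \<open>com_cost\<close> are dummies.\<close>

fun effect :: "com \<Rightarrow> state \<Rightarrow> state" where
  "effect Skip s = s"
| "effect (NSet x e f) s = nset x (nval e s) (nval f s) s"
| "effect (RSet x e f) s = rset x (nval e s) (rval f s) s"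
| "effect (Seq c d) s = effect d (effect c s)"
| "effect (Cond b c d) s = (if bval b s then effect c s else effect d s)"
| "effect (While b c) s = s"

fun com_cost :: "com \<Rightarrow> nat" where
  "com_cost Skip = 1"
| "com_cost (NSet x e f) = ncost e + ncost f + 1"
| "com_cost (RSet x e f) = ncost e + rcost f + 1"
| "com_cost (Seq c d) = com_cost c + com_cost d"
| "com_cost (Cond b c d) = bcost b + max (com_cost c) (com_cost d) + 1"
| "com_cost (While b c) = 0"

lemma exec_loop_free:
  "loop_free c \<Longrightarrow> \<exists>t \<le> com_cost c. exec c s t (effect c s)"
proof (induction c arbitrary: s)
  case (Seq c d)
  then show ?case
    by simp (meson add_mono exec.Seq)
next
  case (Cond b c d)
  show ?case
  proof (cases "bval b s")
    case True
    with Cond obtain t where "t \<le> com_cost c" "exec c s t (effect c s)"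
      by auto
    with CondTrue[OF True this(2), of d] True show ?thesis
      by (intro exI[of _ "bcost b + t + 1"]) auto
  next
    case False
    with Cond obtain t where "t \<le> com_cost d" "exec d s t (effect d s)"
      by auto
    with CondFalse[OF False this(2), of c] False show ?thesis
      by (intro exI[of _ "bcost b + t + 1"]) auto
  qed
next
  case Skip
  show ?case
    using exec.Skip by auto
next
  case (NSet x e f)
  show ?case
    using exec.NSet by (intro exI[of _ "ncost e + ncost f + 1"]) (simp del: add_Suc_right)
next
  case (RSet x e f)
  show ?case
    using exec.RSet by (intro exI[of _ "ncost e + rcost f + 1"]) (simp del: add_Suc_right)
qed simp

lemma runs_loop_free:
  assumes "loop_free c" "Q (effect c s)"
  shows "runs c s (com_cost c) Q"
  using exec_loop_free[OF assms(1)] assms(2) unfolding runs_def by blast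

lemma nats_nset [simp]:
  "nats (nset x k v s) y l = (if x = y \<and> k = l then v else nats s y l)"
  by (auto simp: nset_def)

lemma reals_nset [simp]: "reals (nset x k v s) = reals s"
  by (simp add: nset_def)

lemma reals_rset [simp]:
  "reals (rset x k v s) y l = (if x = y \<and> k = l then v else reals s y l)"
  by (auto simp: rset_def)

lemma nats_rset [simp]: "nats (rset x k v s) = nats s"
  by (simp add: rset_def)


section \<open>Sweeping over all matrix entries\<close>

text \<open>A cursor names three scalar variables: row, column and cell number of the current entry. The
  cell number is maintained by increments because the machine cannot multiply.\<close>

type_synonym cursor = "string \<times> string \<times> string"

abbreviation var :: "string \<Rightarrow> nexp" where
  "var x \<equiv> NGet x (NConst 0)"

abbreviation assign :: "string \<Rightarrow> nexp \<Rightarrow> com" where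
  "assign x e \<equiv> NSet x (NConst 0) e"

fun points :: "problem \<Rightarrow> cursor \<Rightarrow> arg \<Rightarrow> state \<Rightarrow> bool" where
  "points I (i, j, a) u s \<longleftrightarrow> nats s i 0 = fst u \<and> nats s j 0 = snd u \<and>
     nats s a 0 = fst u * num_jobs I + snd u"

text \<open>Row-major order. One increment of the cell number serves both branches, as
  \<open>(i + 1) * n + 1 = (i * n + n) + 1\<close>.\<close>

fun advance :: "cursor \<Rightarrow> com" where
  "advance (i, j, a) =
     Seq (assign a (NPlus (var a) (NConst 1)))
       (Cond (NLess (var j) (var ''n'')) (assign j (NPlus (var j) (NConst 1)))
         (Seq (assign j (NConst 1)) (assign i (NPlus (var i) (NConst 1)))))"

fun sweep :: "cursor \<Rightarrow> com \<Rightarrow> com" where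
  "sweep (i, j, a) c =
     Seq (Seq (assign i (NConst 1))
           (Seq (assign j (NConst 1)) (assign a (NPlus (var ''n'') (NConst 1)))))
       (While (NLess (var i) (NPlus (var ''m'') (NConst 1))) (Seq c (advance (i, j, a))))"

text \<open>Columns in \<open>1..n\<close> differ by less than \<open>n\<close>, whereas a change of
  row shifts the cell by at least \<open>n\<close>; so distinct entries never share a cell, and one
  advance adds exactly one visited entry.\<close>

lemma cell_less_Suc_iff:
  fixes i j i' j' n :: nat
  assumes "1 \<le> j" "j \<le> n" "1 \<le> j'" "j' \<le> n"
  shows "i' * n + j' < Suc (i * n + j) \<longleftrightarrow> i' * n + j' < i * n + j \<or> i' = i \<and> j' = j"
proof -
  have "i' * n + j' = i * n + j \<longleftrightarrow> i' = i \<and> j' = j"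
  proof
    assume eq: "i' * n + j' = i * n + j"
    have False if "i' < i"
    proof -
      have "Suc i' * n \<le> i * n" using that by (intro mult_le_mono1) simp
      with eq assms show False by simp
    qed
    moreover have False if "i < i'"
    proof -
      have "Suc i * n \<le> i' * n" using that by (intro mult_le_mono1) simp
      with eq assms show False by simp
    qed
    ultimately have "i' = i" by (meson linorder_neqE_nat)
    with eq show "i' = i \<and> j' = j" by simp
  qed simp
  then show ?thesis by auto
qed

text \<open>Clients reason only about sets of visited entries. \<open>frame\<close> allows the
  cursor to move, and \<open>u \<notin> V\<close> lets a body accumulate sums without counting an
  entry twice.\<close>

lemma runs_sweep:
  assumes dist: "distinct [i, j, a, ''m'', ''n'']"
    and inst: "makespan_instance I"
    and dims: "\<And>V s. Inv V s \<Longrightarrow> nats s ''m'' 0 = num_machines I \<and> nats s ''n'' 0 = num_jobs I"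
    and frame: "\<And>V s x v. x \<in> {i, j, a} \<Longrightarrow> Inv V s \<Longrightarrow> Inv V (nset x 0 v s)"
    and body: "\<And>V s u. V \<subseteq> machines I \<times> jobs I \<Longrightarrow> u \<in> machines I \<times> jobs I \<Longrightarrow> u \<notin> V \<Longrightarrow>
      points I (i, j, a) u s \<Longrightarrow> Inv V s \<Longrightarrow>
      runs c s T (\<lambda>s'. points I (i, j, a) u s' \<and> Inv (insert u V) s')"
    and start: "Inv {} s"
  shows "runs (sweep (i, j, a) c) s (num_machines I * num_jobs I * (T + 50))
    (Inv (machines I \<times> jobs I))"
proof -
  let ?M = "num_machines I" and ?N = "num_jobs I"
  have pos: "1 \<le> ?M" "1 \<le> ?N"
    using inst by (auto simp: makespan_instance_def)
  define visited where
    "visited q = {(i', j'). i' \<in> machines I \<and> j' \<in> jobs I \<and> i' * ?N + j' < q}" for q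
  define P where "P s \<longleftrightarrow> (\<exists>u. points I (i, j, a) u s \<and> 1 \<le> fst u \<and> fst u \<le> ?M + 1 \<and>
    1 \<le> snd u \<and> snd u \<le> ?N \<and> Inv (visited (nats s a 0)) s)" for s :: state
  \<comment> \<open>\<open>(m + 1) * n + 1\<close> is the cell number of the exit position
    \<open>(m + 1, 1)\<close>, so \<open>f\<close> counts the entries still to come.\<close>
  define f where "f s = (?M + 1) * ?N + 1 - nats s a 0" for s :: state
  let ?test = "NLess (var i) (NPlus (var ''m'') (NConst 1))"
  let ?init = "Seq (assign i (NConst 1))
           (Seq (assign j (NConst 1)) (assign a (NPlus (var ''n'') (NConst 1))))"
  have step: "runs (Seq c (advance (i, j, a))) s (T + 21) (\<lambda>s'. P s' \<and> f s' < f s)"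
    if "P s" "bval ?test s" for s
  proof -
    from \<open>P s\<close> obtain u where u: "points I (i, j, a) u s" "1 \<le> fst u"
      "1 \<le> snd u" "snd u \<le> ?N" and Inv: "Inv (visited (nats s a 0)) s"
      unfolding P_def by blast
    have fst_u: "fst u \<le> ?M"
      using \<open>bval ?test s\<close> u(1) dims[OF Inv] by simp
    let ?q = "fst u * ?N + snd u"
    have q: "nats s a 0 = ?q"
      using u by simp
    have uin: "u \<in> machines I \<times> jobs I"
      using u fst_u by (cases u) (auto simp: machines_def jobs_def)
    have ins: "insert u (visited ?q) = visited (Suc ?q)"
      using uin u cell_less_Suc_iff[OF u(3,4)]
      by (cases u) (auto simp: visited_def jobs_def)
    have "fst u * ?N \<le> ?M * ?N"
      using fst_u by (intro mult_le_mono1)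
    then have qle: "?q < (?M + 1) * ?N + 1"
      using u(4) unfolding add_mult_distrib by linarith
    have "runs c s T (\<lambda>s'. points I (i, j, a) u s' \<and> Inv (insert u (visited ?q)) s')"
      using Inv u(1) uin by (intro body) (auto simp: visited_def q)
    then have "runs (Seq c (advance (i, j, a))) s (T + com_cost (advance (i, j, a)))
      (\<lambda>s'. P s' \<and> f s' < f s)"
    proof (rule runs_Seq)
      fix s1
      assume s1: "points I (i, j, a) u s1 \<and> Inv (insert u (visited ?q)) s1"
      have inv1: "Inv (visited (Suc ?q)) s1"
        using s1 ins by simp
      show "runs (advance (i, j, a)) s1 (com_cost (advance (i, j, a))) (\<lambda>s'. P s' \<and> f s' < f s)"
      proof (rule runs_loop_free)
        let ?s' = "effect (advance (i, j, a)) s1"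
        have a': "nats ?s' a 0 = Suc ?q"
          using s1 dist by auto
        have "Inv (visited (Suc ?q)) ?s'"
          using inv1 by (auto intro!: frame)
        moreover have "\<exists>w. points I (i, j, a) w ?s' \<and> 1 \<le> fst w \<and> fst w \<le> ?M + 1 \<and>
            1 \<le> snd w \<and> snd w \<le> ?N"
        proof (cases "snd u < ?N")
          case True
          with s1 dist u fst_u dims[OF inv1] show ?thesis
            by (intro exI[of _ "(fst u, Suc (snd u))"]) auto
        next
          case False
          with s1 dist u fst_u dims[OF inv1] pos show ?thesis
            by (intro exI[of _ "(Suc (fst u), 1)"]) auto
        qed
        ultimately have "P ?s'"
          unfolding P_def a' by blast
        moreover have "f ?s' < f s"
          unfolding f_def a' q using qle by simp
        ultimately show "P ?s' \<and> f ?s' < f s" ..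
      qed simp
    qed
    then show ?thesis
      by (rule runs_mono) auto
  qed
  have "runs ?init s (com_cost ?init) (\<lambda>s'. P s' \<and> f s' = ?M * ?N)"
  proof (rule runs_loop_free)
    let ?s' = "effect ?init s"
    have a': "nats ?s' a 0 = ?N + 1"
      using dist dims[OF start] by auto
    have "visited (?N + 1) = {}"
    proof -
      have "\<not> i' * ?N + j' < ?N + 1" if "1 \<le> i'" "1 \<le> j'" for i' j'
      proof -
        have "1 * ?N \<le> i' * ?N"
          using that by (intro mult_le_mono1)
        with that show ?thesis
          by linarith
      qed
      then show ?thesis
        by (auto simp: visited_def machines_def jobs_def)
    qed
    moreover have "Inv {} ?s'"
      using start by (auto intro!: frame)
    moreover have "points I (i, j, a) (1, 1) ?s'"
      using dist dims[OF start] by auto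
    ultimately have "P ?s'"
      unfolding P_def a' using pos by (intro exI[of _ "(1, 1)"]) auto
    moreover have "f ?s' = ?M * ?N"
      unfolding f_def a' by simp
    ultimately show "P ?s' \<and> f ?s' = ?M * ?N" ..
  qed simp
  then have "runs (sweep (i, j, a) c) s
      (com_cost ?init + (?M * ?N * (T + 21 + bcost ?test + 1) + bcost ?test + 1))
      (\<lambda>s'. P s' \<and> \<not> bval ?test s')"
    unfolding sweep.simps
  proof (rule runs_Seq)
    fix s1
    assume "P s1 \<and> f s1 = ?M * ?N"
    then show "runs (While ?test (Seq c (advance (i, j, a)))) s1
        (?M * ?N * (T + 21 + bcost ?test + 1) + bcost ?test + 1) (\<lambda>s'. P s' \<and> \<not> bval ?test s')"
      using runs_While[where P = P and f = f and b = ?test, OF _ step, of s1] by auto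
  qed
  then show ?thesis
  proof (rule runs_mono)
    \<comment> \<open>Each entry costs 29 beyond the body (21 to advance, 8 for the test) and 20 are
      paid once; since \<open>1 \<le> X\<close>, 50 per entry suffices.\<close>
    have "com_cost ?init + (X * (T + 21 + bcost ?test + 1) + bcost ?test + 1) \<le> X * (T + 50)"
      if "1 \<le> X" for X
      using that by (simp add: add_mult_distrib2)
    moreover have "1 \<le> ?M * ?N"
      using pos by simp
    ultimately show "com_cost ?init + (?M * ?N * (T + 21 + bcost ?test + 1) + bcost ?test + 1)
      \<le> ?M * ?N * (T + 50)"
      by blast
  next
    fix s'
    assume s': "P s' \<and> \<not> bval ?test s'"
    then obtain u where pt: "points I (i, j, a) u s'" and u: "1 \<le> snd u"
      and Inv: "Inv (visited (nats s' a 0)) s'"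
      unfolding P_def by blast
    have "?M + 1 \<le> fst u"
      using s' pt dims[OF Inv] by simp
    then    have "(?M + 1) * ?N \<le> fst u * ?N"
      by (intro mult_le_mono1)
    then have *: "?M * ?N + ?N < nats s' a 0"
      using pt u by simp
    have "i' * ?N + j' < nats s' a 0" if "i' \<le> ?M" "j' \<le> ?N" for i' j'
    proof -
      have "i' * ?N \<le> ?M * ?N"
        using that by (intro mult_le_mono1)
      with * that show ?thesis
        by linarith
    qed
    then have "visited (nats s' a 0) = machines I \<times> jobs I"
      by (auto simp: visited_def machines_def jobs_def)
    with Inv show "Inv (machines I \<times> jobs I) s'"
      by simp
  qed
qed


section \<open>Completion times and makespan\<close>

abbreviation inner :: cursor where
  "inner \<equiv> (''i'', ''j'', ''a'')"

abbreviation outer :: cursor where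
  "outer \<equiv> (''k'', ''l'', ''b'')"

abbreviation entry :: "string \<Rightarrow> string \<Rightarrow> bexp" where
  "entry x a \<equiv> NLess (NConst 0) (NGet x (var a))"

text \<open>Work that concerns a whole row is repeated at each of its entries, which still costs
  only \<open>O(m * n)\<close> and keeps \<open>sweep\<close> as the only loop. Starting
  \<open>M\<close> from machine 1 makes it an attained completion time throughout.\<close>

definition preprocess :: com where
  "preprocess =
     Seq (sweep inner (RSet ''C'' (var ''i'') RZero))
    (Seq (sweep inner (Cond (entry ''x'' ''a'')
           (RSet ''C'' (var ''i'') (RPlus (RGet ''C'' (var ''i'')) (RGet ''p'' (var ''j'')))) Skip))
    (Seq (RSet ''M'' (NConst 0) (RGet ''C'' (NConst 1)))
         (sweep inner (Cond (RLess (RGet ''M'' (NConst 0)) (RGet ''C'' (var ''i'')))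
           (RSet ''M'' (NConst 0) (RGet ''C'' (var ''i''))) Skip))))"

definition env :: "problem \<Rightarrow> schedule \<Rightarrow> decisions \<Rightarrow> state \<Rightarrow> bool" where
  "env I S D s \<longleftrightarrow> is_input I S D s \<and> (\<forall>i\<in>machines I. reals s ''C'' i = completion I S i) \<and>
     reals s ''M'' 0 = makespan I S"

lemma is_input_nset [simp]:
  "x \<notin> {''m'', ''n'', ''x'', ''neg'', ''pos''} \<Longrightarrow>
     is_input I S D (nset x k v s) \<longleftrightarrow> is_input I S D s"
  by (simp add: is_input_def)

lemma is_input_rset [simp]:
  "x \<noteq> ''p'' \<Longrightarrow> is_input I S D (rset x k v s) \<longleftrightarrow> is_input I S D s"
  by (simp add: is_input_def)

lemma env_nset [simp]:
  "x \<notin> {''m'', ''n'', ''x'', ''neg'', ''pos''} \<Longrightarrow> env I S D (nset x k v s) \<longleftrightarrow> env I S D s"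
  by (simp add: env_def)

lemma is_input_dims:
  "is_input I S D s \<Longrightarrow> nats s ''m'' 0 = num_machines I \<and> nats s ''n'' 0 = num_jobs I"
  by (simp add: is_input_def)

lemma is_input_entries:
  assumes "is_input I S D s" "i \<in> machines I" "j \<in> jobs I"
  shows "nats s ''x'' (i * num_jobs I + j) = S i j"
    and "nats s ''neg'' (i * num_jobs I + j) = of_bool ((i, j) \<in> fst D)"
    and "nats s ''pos'' (i * num_jobs I + j) = of_bool ((i, j) \<in> snd D)"
    and "reals s ''p'' j = ptime I j"
  using assms by (simp_all add: is_input_def)

lemma runs_preprocess:
  assumes inst: "makespan_instance I" and sched: "is_schedule I S" and input: "is_input I S D s"
  shows "runs preprocess s (num_machines I * num_jobs I * 300) (env I S D)"
proof -
  let ?X = "num_machines I * num_jobs I"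
  let ?cells = "machines I \<times> jobs I"
  let ?reset = "RSet ''C'' (var ''i'') RZero"
  let ?add = "Cond (entry ''x'' ''a'')
    (RSet ''C'' (var ''i'') (RPlus (RGet ''C'' (var ''i'')) (RGet ''p'' (var ''j'')))) Skip"
  let ?first = "RSet ''M'' (NConst 0) (RGet ''C'' (NConst 1))"
  let ?max = "Cond (RLess (RGet ''M'' (NConst 0)) (RGet ''C'' (var ''i'')))
    (RSet ''M'' (NConst 0) (RGet ''C'' (var ''i''))) Skip"
  have one: "1 \<in> machines I" "1 \<in> jobs I"
    using inst by (auto simp: makespan_instance_def machines_def jobs_def)
  define R where "R V s \<longleftrightarrow> is_input I S D s \<and> (\<forall>(i, j)\<in>V. reals s ''C'' i = 0)"
    for V :: "arg set" and s :: state
  \<comment> \<open>Partial sums over the visited entries; as entries are 0 or 1, the conditional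
    addition realises the product \<open>S i j * ptime I j\<close>.\<close>
  define A where "A V s \<longleftrightarrow> is_input I S D s \<and> (\<forall>i\<in>machines I.
    reals s ''C'' i = (\<Sum>j\<in>{j \<in> jobs I. (i, j) \<in> V}. real (S i j) * ptime I j))"
    for V :: "arg set" and s :: state
  \<comment> \<open>\<open>M\<close> is attained and dominates the visited rows; after the sweep
    these two facts characterise \<open>Max\<close>.\<close>
  define Z where "Z V s \<longleftrightarrow> is_input I S D s \<and>
    (\<forall>i\<in>machines I. reals s ''C'' i = completion I S i) \<and>
    reals s ''M'' 0 \<in> completion I S ` machines I \<and>
    (\<forall>(i, j)\<in>V. completion I S i \<le> reals s ''M'' 0)"
    for V :: "arg set" and s :: state
  have 1: "runs (sweep inner ?reset) s (?X * (com_cost ?reset + 50)) (R ?cells)"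
  proof (rule runs_sweep[OF _ inst])
    fix V s u
    assume "points I inner u s" "R V s"
    then show "runs ?reset s (com_cost ?reset) (\<lambda>s'. points I inner u s' \<and> R (insert u V) s')"
      by (intro runs_loop_free) (auto simp: R_def)
  qed (use input in \<open>auto simp: R_def is_input_dims\<close>)
  have 2: "runs (sweep inner ?add) s (?X * (com_cost ?add + 50)) (A ?cells)" if "R ?cells s" for s
  proof (rule runs_sweep[OF _ inst])
    \<comment> \<open>Every row contains column 1, so a sweep over all entries has reset every
      row.\<close>
    show "A {} s"
      using that one by (auto simp: A_def R_def)
  next
    fix V s u
    assume u: "u \<in> ?cells" "u \<notin> V" and pt: "points I inner u s" and A: "A V s"
    obtain i j where ij: "u = (i, j)" "i \<in> machines I" "j \<in> jobs I"
      using u by auto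
    have s: "is_input I S D s"
      using A by (simp add: A_def)
    have "{j' \<in> jobs I. (i', j') \<in> insert u V} =
        (if i' = i then insert j {j' \<in> jobs I. (i', j') \<in> V} else {j' \<in> jobs I. (i', j') \<in> V})" for i'
      using ij by auto
    moreover have "j \<notin> {j' \<in> jobs I. (i, j') \<in> V}"
      using u ij by auto
    moreover have "S i j = 0 \<or> S i j = 1"
      using sched ij by (auto simp: is_schedule_def)
    ultimately show "runs ?add s (com_cost ?add)
        (\<lambda>s'. points I inner u s' \<and> A (insert u V) s')"
      using A pt ij is_input_entries[OF s ij(2,3)]
      by (intro runs_loop_free) (auto simp: A_def)
  qed (auto simp: A_def is_input_dims)
  have 3: "runs ?first s (com_cost ?first) (Z {})" if "A ?cells s" for s
  proof (rule runs_loop_free)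
    have "{j \<in> jobs I. (i, j) \<in> ?cells} = jobs I" if "i \<in> machines I" for i
      using that by auto
    then show "Z {} (effect ?first s)"
      using that one by (auto simp: Z_def A_def completion_def)
  qed simp
  have 4: "runs (sweep inner ?max) s (?X * (com_cost ?max + 50)) (Z ?cells)" if "Z {} s" for s
  proof (rule runs_sweep[OF _ inst])
    fix V s u
    assume "u \<in> ?cells" "points I inner u s" "Z V s"
    then show "runs ?max s (com_cost ?max) (\<lambda>s'. points I inner u s' \<and> Z (insert u V) s')"
      by (intro runs_loop_free) (fastforce simp: Z_def)+
  qed (use that in \<open>auto simp: Z_def is_input_dims\<close>)
  have final: "env I S D s" if "Z ?cells s" for s
  proof -
    have "reals s ''M'' 0 = makespan I S"
      unfolding makespan_def using that one
      by (intro Max_eqI[symmetric]) (auto simp: Z_def)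
    with that show ?thesis
      by (simp add: env_def Z_def)
  qed
  \<comment> \<open>The three sweeps cost 182 per entry and initialising \<open>M\<close> costs 4;
    300 is a generous round bound.\<close>
  have "X * (com_cost ?reset + 50) + (X * (com_cost ?add + 50) +
      (com_cost ?first + X * (com_cost ?max + 50))) \<le> X * 300" if "1 \<le> X" for X
    using that by simp
  moreover have "1 \<le> ?X"
    using inst by (simp add: makespan_instance_def)
  ultimately show ?thesis
    using runs_Seq[OF 1 runs_Seq[OF 2 runs_Seq[OF 3 4]]] final
    unfolding preprocess_def by (blast intro: runs_mono)
qed


section \<open>Searching for explanations\<close>

text \<open>Reading the output arrays as a set turns appending a record into \<open>insert\<close>,
  whatever the order of discovery.\<close>

definition recorded_attacks :: "state \<Rightarrow> (arg \<times> arg) set" where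
  "recorded_attacks s =
     (\<lambda>q. ((nats s ''src_i'' q, nats s ''src_j'' q), (nats s ''dst_i'' q, nats s ''dst_j'' q))) `
       {..<nats s ''attacks'' 0}"

definition recorded_nonattacks :: "state \<Rightarrow> arg set" where
  "recorded_nonattacks s =
     (\<lambda>q. (nats s ''non_i'' q, nats s ''non_j'' q)) ` {..<nats s ''nonattacks'' 0}"

lemma output_explanations_eq:
  "output_explanations E s =
     {Attack u v | u v. (u, v) \<in> recorded_attacks s} \<union> {NonAttack E v | v. v \<in> recorded_nonattacks s}"
  by (auto simp: output_explanations_def recorded_attacks_def recorded_nonattacks_def)

lemma recorded_attacks_nset [simp]:
  "x \<notin> {''src_i'', ''src_j'', ''dst_i'', ''dst_j'', ''attacks''} \<Longrightarrow>
     recorded_attacks (nset x k v s) = recorded_attacks s"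
  by (simp add: recorded_attacks_def)

lemma recorded_nonattacks_nset [simp]:
  "x \<notin> {''non_i'', ''non_j'', ''nonattacks''} \<Longrightarrow>
     recorded_nonattacks (nset x k v s) = recorded_nonattacks s"
  by (simp add: recorded_nonattacks_def)

definition record_attack :: com where
  "record_attack =
     Seq (NSet ''src_i'' (var ''attacks'') (var ''i''))
    (Seq (NSet ''src_j'' (var ''attacks'') (var ''j''))
    (Seq (NSet ''dst_i'' (var ''attacks'') (var ''k''))
    (Seq (NSet ''dst_j'' (var ''attacks'') (var ''l''))
         (assign ''attacks'' (NPlus (var ''attacks'') (NConst 1))))))"

definition record_nonattack :: com where
  "record_nonattack =
     Seq (NSet ''non_i'' (var ''nonattacks'') (var ''k''))
    (Seq (NSet ''non_j'' (var ''nonattacks'') (var ''l''))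
         (assign ''nonattacks'' (NPlus (var ''nonattacks'') (NConst 1))))"

text \<open>The new record is written at the first uncounted index, so earlier records are
  untouched.\<close>

lemma recorded_attacks_record_attack:
  assumes "points I inner u s" "points I outer v s"
  shows "recorded_attacks (effect record_attack s) = insert (u, v) (recorded_attacks s)"
  using assms
  by (cases u; cases v) (simp add: record_attack_def recorded_attacks_def lessThan_Suc cong: image_cong_simp)

lemma recorded_nonattacks_record_nonattack:
  assumes "points I outer v s"
  shows "recorded_nonattacks (effect record_nonattack s) = insert v (recorded_nonattacks s)"
  using assms
  by (cases v) (simp add: record_nonattack_def recorded_nonattacks_def lessThan_Suc cong: image_cong_simp)

text \<open>For the target \<open>v\<close> under the outer cursor, \<open>bad\<close> tells that some argument \<open>u\<close> rules out \<open>v\<close> as a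
  non-attack explanation, and \<open>good\<close> that some \<open>u\<close> provides the counterattack required for
  efficiency.\<close>

definition test_pair :: "bexp \<Rightarrow> bexp \<Rightarrow> bexp \<Rightarrow> com" where
  "test_pair A B G =
     Seq (Cond A record_attack Skip)
    (Seq (Cond B (assign ''bad'' (NConst 1)) Skip)
         (Cond G (assign ''good'' (NConst 1)) Skip))"

definition reset_flags :: com where
  "reset_flags = Seq (assign ''bad'' (NConst 0)) (assign ''good'' (NConst 0))"

definition conclude :: com where
  "conclude =
     Cond (BAnd (BNot (entry ''x'' ''b'')) (BAnd (BNot (NLess (NConst 0) (var ''bad'')))
         (NLess (NConst 0) (var ''good''))))
       record_nonattack Skip"

text \<open>One skeleton for all three properties, which differ only in the tests. The outer cursor
  runs over targets because the verdict on a non-attack needs all sources for a fixed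
  target.\<close>

definition search :: "bexp \<Rightarrow> bexp \<Rightarrow> bexp \<Rightarrow> com" where
  "search A B G =
     Seq (Seq (assign ''attacks'' (NConst 0)) (assign ''nonattacks'' (NConst 0)))
       (sweep outer (Seq reset_flags (Seq (sweep inner (test_pair A B G)) conclude)))"

text \<open>A test needs to be right only where the search evaluates it: after preprocessing, with
  both cursors on matrix entries.\<close>

definition decides ::
  "problem \<Rightarrow> schedule \<Rightarrow> decisions \<Rightarrow> bexp \<Rightarrow> (arg \<Rightarrow> arg \<Rightarrow> bool) \<Rightarrow> bool"
where
  "decides I S D b P \<longleftrightarrow> (\<forall>s u v. env I S D s \<longrightarrow> points I inner u s \<longrightarrow> points I outer v s \<longrightarrow>
     u \<in> machines I \<times> jobs I \<longrightarrow> v \<in> machines I \<times> jobs I \<longrightarrow> (bval b s \<longleftrightarrow> P u v))"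

lemma decidesD:
  assumes "decides I S D b P" "env I S D s" "points I inner u s" "points I outer v s"
    "u \<in> machines I \<times> jobs I" "v \<in> machines I \<times> jobs I"
  shows "bval b s \<longleftrightarrow> P u v"
  using assms unfolding decides_def by blast

lemma effect_test_pair:
  assumes dec: "decides I S D A PA" "decides I S D B PB" "decides I S D G PG"
    and s: "env I S D s" "points I inner u s" "points I outer v s"
    and uv: "u \<in> machines I \<times> jobs I" "v \<in> machines I \<times> jobs I"
  defines "s' \<equiv> effect (test_pair A B G) s"
  shows "env I S D s'" "points I inner u s'" "points I outer v s'"
    and "recorded_attacks s' = (if PA u v then insert (u, v) else id) (recorded_attacks s)"
    and "recorded_nonattacks s' = recorded_nonattacks s"
    and "nats s' ''bad'' 0 = (if PB u v then 1 else nats s ''bad'' 0)"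
    and "nats s' ''good'' 0 = (if PG u v then 1 else nats s ''good'' 0)"
proof -
  let ?ok = "\<lambda>s. env I S D s \<and> points I inner u s \<and> points I outer v s"
  \<comment> \<open>Each test is evaluated in the state left by its predecessor; \<open>?ok\<close>
    is carried along so that \<open>decidesD\<close> applies again.\<close>
  define s1 where "s1 = (if PA u v then effect record_attack s else s)"
  define s2 where "s2 = (if PB u v then nset ''bad'' 0 1 s1 else s1)"
  define s3 where "s3 = (if PG u v then nset ''good'' 0 1 s2 else s2)"
  have 1: "?ok s1" "recorded_attacks s1 = (if PA u v then insert (u, v) else id) (recorded_attacks s)"
    "recorded_nonattacks s1 = recorded_nonattacks s"
    "nats s1 ''bad'' 0 = nats s ''bad'' 0" "nats s1 ''good'' 0 = nats s ''good'' 0"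
    unfolding s1_def using s recorded_attacks_record_attack[OF s(2,3)]
    by (simp_all add: record_attack_def)
  have 2: "?ok s2" "recorded_attacks s2 = recorded_attacks s1"
    "recorded_nonattacks s2 = recorded_nonattacks s1"
    unfolding s2_def using 1 by simp_all
  have 3: "?ok s3" "recorded_attacks s3 = recorded_attacks s2"
    "recorded_nonattacks s3 = recorded_nonattacks s2"
    unfolding s3_def using 2 by simp_all
  have "effect (Cond A record_attack Skip) s = s1"
    using decidesD[OF dec(1) s uv] by (simp add: s1_def)
  moreover have "effect (Cond B (assign ''bad'' (NConst 1)) Skip) s1 = s2"
    using 1(1) decidesD[OF dec(2) _ _ _ uv, of s1] by (simp add: s2_def)
  moreover have "effect (Cond G (assign ''good'' (NConst 1)) Skip) s2 = s3"
    using 2(1) decidesD[OF dec(3) _ _ _ uv, of s2] by (simp add: s3_def)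
  ultimately have "s' = s3"
    unfolding s'_def test_pair_def effect.simps(4) by simp
  with 1 2 3 show "env I S D s'" "points I inner u s'" "points I outer v s'"
    "recorded_attacks s' = (if PA u v then insert (u, v) else id) (recorded_attacks s)"
    "recorded_nonattacks s' = recorded_nonattacks s"
    "nats s' ''bad'' 0 = (if PB u v then 1 else nats s ''bad'' 0)"
    "nats s' ''good'' 0 = (if PG u v then 1 else nats s ''good'' 0)"
    by (simp_all add: s2_def s3_def)
qed

lemma loop_free_test_pair [simp]: "loop_free (test_pair A B G)"
  by (simp add: test_pair_def record_attack_def)

lemma effect_conclude:
  assumes s: "env I S D s" "points I outer v s" and v: "v \<in> machines I \<times> jobs I"
  defines "s' \<equiv> effect conclude s"
  shows "env I S D s'" "points I outer v s'" "recorded_attacks s' = recorded_attacks s"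
    and "recorded_nonattacks s' =
      (if S (fst v) (snd v) = 0 \<and> nats s ''bad'' 0 = 0 \<and> nats s ''good'' 0 \<noteq> 0
       then insert v else id) (recorded_nonattacks s)"
proof -
  have "nats s ''x'' (nats s ''b'' 0) = S (fst v) (snd v)"
    using s v by (auto simp: env_def is_input_entries)
  moreover have "env I S D (effect record_nonattack s)" "points I outer v (effect record_nonattack s)"
    "recorded_attacks (effect record_nonattack s) = recorded_attacks s"
    using s by (simp_all add: record_nonattack_def)
  ultimately show "env I S D s'" "points I outer v s'" "recorded_attacks s' = recorded_attacks s"
    "recorded_nonattacks s' =
      (if S (fst v) (snd v) = 0 \<and> nats s ''bad'' 0 = 0 \<and> nats s ''good'' 0 \<noteq> 0
       then insert v else id) (recorded_nonattacks s)"
    using s recorded_nonattacks_record_nonattack[OF s(2)] by (auto simp: s'_def conclude_def)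
qed

lemma runs_search:
  assumes inst: "makespan_instance I"
    and dec: "decides I S D A PA" "decides I S D B PB" "decides I S D G PG"
    and start: "env I S D s"
  defines "cells \<equiv> machines I \<times> jobs I"
  shows "runs (search A B G) s
    ((num_machines I * num_jobs I) ^ 2 * (com_cost (test_pair A B G) + com_cost conclude + 200))
    (\<lambda>s'. recorded_attacks s' = {(u, v). u \<in> cells \<and> v \<in> cells \<and> PA u v} \<and>
       recorded_nonattacks s' = {v \<in> cells. S (fst v) (snd v) = 0 \<and>
         (\<forall>u\<in>cells. \<not> PB u v) \<and> (\<exists>u\<in>cells. PG u v)})"
proof -
  let ?X = "num_machines I * num_jobs I"
  let ?pair = "test_pair A B G"
  let ?init = "Seq (assign ''attacks'' (NConst 0)) (assign ''nonattacks'' (NConst 0))"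
  define N where "N v \<longleftrightarrow> S (fst v) (snd v) = 0 \<and> (\<forall>u\<in>cells. \<not> PB u v) \<and> (\<exists>u\<in>cells. PG u v)" for v
  define Out where "Out V s \<longleftrightarrow> env I S D s \<and>
    recorded_attacks s = {(u, v). u \<in> cells \<and> v \<in> V \<and> PA u v} \<and>
    recorded_nonattacks s = {v \<in> V. N v}" for V s
  \<comment> \<open>\<open>V\<close> holds the finished targets and \<open>U\<close> the sources
    already tried against \<open>v\<close>. At \<open>U = cells\<close> the flags settle the
    quantifiers in \<open>N v\<close>.\<close>
  define In where "In v V U s \<longleftrightarrow> env I S D s \<and> points I outer v s \<and>
    recorded_attacks s = {(u, v). u \<in> cells \<and> v \<in> V \<and> PA u v} \<union> {(u, v) | u. u \<in> U \<and> PA u v} \<and>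
    recorded_nonattacks s = {v \<in> V. N v} \<and>
    (nats s ''bad'' 0 \<noteq> 0 \<longleftrightarrow> (\<exists>u\<in>U. PB u v)) \<and>
    (nats s ''good'' 0 \<noteq> 0 \<longleftrightarrow> (\<exists>u\<in>U. PG u v))" for v V U s
  have dims: "nats s ''m'' 0 = num_machines I \<and> nats s ''n'' 0 = num_jobs I" if "env I S D s" for s
    using that is_input_dims[of I S D s] by (simp add: env_def)
  have inner: "runs (sweep inner ?pair) s (?X * (com_cost ?pair + 50)) (In v V cells)"
    if v: "v \<in> cells" and In: "In v V {} s" for v V s
    unfolding cells_def
  proof (rule runs_sweep[OF _ inst])
    fix U s u
    assume u: "u \<in> machines I \<times> jobs I" and pt: "points I inner u s" and In: "In v V U s"
    show "runs ?pair s (com_cost ?pair) (\<lambda>s'. points I inner u s' \<and> In v V (insert u U) s')"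
    proof (rule runs_loop_free)
      have s: "env I S D s" "points I outer v s"
        using In by (simp_all only: In_def)
      note eff = effect_test_pair[OF dec s(1) pt s(2) u v[unfolded cells_def]]
      have "recorded_attacks (effect ?pair s) = {(u, v). u \<in> cells \<and> v \<in> V \<and> PA u v} \<union>
          {(u', v) | u'. u' \<in> insert u U \<and> PA u' v}"
        using In by (auto simp: eff(4) In_def)
      moreover have "nats (effect ?pair s) ''bad'' 0 \<noteq> 0 \<longleftrightarrow> (\<exists>u\<in>insert u U. PB u v)"
        using In by (auto simp: eff(6) In_def)
      moreover have "nats (effect ?pair s) ''good'' 0 \<noteq> 0 \<longleftrightarrow> (\<exists>u\<in>insert u U. PG u v)"
        using In by (auto simp: eff(7) In_def)
      moreover have "recorded_nonattacks (effect ?pair s) = {v \<in> V. N v}"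
        using In by (simp only: eff(5) In_def)
      ultimately show "points I inner u (effect ?pair s) \<and> In v V (insert u U) (effect ?pair s)"
        unfolding In_def using eff(1-3) by blast
    qed simp
  next
    fix U s x w
    assume "x \<in> {''i'', ''j'', ''a''}" "In v V U s"
    then show "In v V U (nset x 0 w s)"
      by (elim insertE emptyE) (simp_all add: In_def)
  qed (use In dims in \<open>auto simp: In_def\<close>)
  have body: "runs (Seq reset_flags (Seq (sweep inner ?pair) conclude)) s
      (com_cost reset_flags + (?X * (com_cost ?pair + 50) + com_cost conclude))
      (\<lambda>s'. points I outer v s' \<and> Out (insert v V) s')"
    if v: "v \<in> cells" and pt: "points I outer v s" and Out: "Out V s" for v V s
  proof (rule runs_Seq)
    show "runs reset_flags s (com_cost reset_flags) (In v V {})"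
      using pt Out by (intro runs_loop_free) (simp_all add: reset_flags_def Out_def In_def)
  next
    fix s1
    assume "In v V {} s1"
    from inner[OF v this]
    show "runs (Seq (sweep inner ?pair) conclude) s1 (?X * (com_cost ?pair + 50) + com_cost conclude)
      (\<lambda>s'. points I outer v s' \<and> Out (insert v V) s')"
    proof (rule runs_Seq)
      fix s2
      assume In: "In v V cells s2"
      then have s2: "env I S D s2" "points I outer v s2"
        by (simp_all only: In_def)
      note eff = effect_conclude[OF s2 v[unfolded cells_def]]
      show "runs conclude s2 (com_cost conclude) (\<lambda>s'. points I outer v s' \<and> Out (insert v V) s')"
      proof (rule runs_loop_free)
        have "recorded_attacks (effect conclude s2) =
            {(u, v'). u \<in> cells \<and> v' \<in> insert v V \<and> PA u v'}"
          using In by (auto simp: eff(3) In_def)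
        moreover have "N v \<longleftrightarrow>
            S (fst v) (snd v) = 0 \<and> nats s2 ''bad'' 0 = 0 \<and> nats s2 ''good'' 0 \<noteq> 0"
          using In unfolding In_def N_def by blast
        then have "recorded_nonattacks (effect conclude s2) = {v' \<in> insert v V. N v'}"
          using In by (auto simp: eff(4) In_def)
        ultimately show "points I outer v (effect conclude s2) \<and> Out (insert v V) (effect conclude s2)"
          unfolding Out_def using eff(1,2) by blast
      qed (simp add: conclude_def record_nonattack_def)
    qed
  qed
  have "runs ?init s (com_cost ?init) (Out {})"
    using start
    by (intro runs_loop_free)
      (simp_all add: Out_def recorded_attacks_def recorded_nonattacks_def)
  then have "runs (search A B G) s (com_cost ?init +
      ?X * ((com_cost reset_flags + (?X * (com_cost ?pair + 50) + com_cost conclude)) + 50))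
    (Out cells)"
    unfolding search_def
  proof (rule runs_Seq)
    fix s
    assume "Out {} s"
    then show "runs (sweep outer (Seq reset_flags (Seq (sweep inner ?pair) conclude))) s
      (?X * ((com_cost reset_flags + (?X * (com_cost ?pair + 50) + com_cost conclude)) + 50)) (Out cells)"
      unfolding cells_def
    proof (intro runs_sweep[OF _ inst])
      fix V s x w
      assume "x \<in> {''k'', ''l'', ''b''}" "Out V s"
      then show "Out V (nset x 0 w s)"
        by (elim insertE emptyE) (simp_all add: Out_def)
    qed (use body dims in \<open>auto simp: Out_def cells_def\<close>)
  qed
  then show ?thesis
  proof (rule runs_mono)
    \<comment> \<open>Here \<open>X \<le> X ^ 2\<close> absorbs the lower-order terms: 6 for the
      counters, 56 per target and 50 per pair give 112, which is below 200.\<close>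
    have "com_cost ?init + X * ((com_cost reset_flags + (X * (a + 50) + b)) + 50)
        \<le> X ^ 2 * (a + b + 200)" if "1 \<le> X" for X a b :: nat
    proof -
      have "X \<le> X ^ 2" "X * b \<le> X ^ 2 * b"
        using that by (simp_all add: power2_eq_square)
      with that have "6 + X * b + X * 56 \<le> X ^ 2 * b + X ^ 2 * 62"
        by linarith
      then show ?thesis
        by (simp add: reset_flags_def algebra_simps power2_eq_square)
    qed
    moreover have "1 \<le> ?X"
      using inst by (simp add: makespan_instance_def)
    ultimately show "com_cost ?init +
      ?X * ((com_cost reset_flags + (?X * (com_cost ?pair + 50) + com_cost conclude)) + 50)
      \<le> ?X ^ 2 * (com_cost ?pair + com_cost conclude + 200)"
      by blast
  qed (auto simp: Out_def N_def)
qed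


section \<open>Attacks as tests\<close>

text \<open>The machine offers only \<open><\<close>, negation and conjunction, so equality and
  disjunction have to be assembled.\<close>

definition neq_exp :: "nexp \<Rightarrow> nexp \<Rightarrow> bexp" where
  "neq_exp e f = BNot (BAnd (BNot (NLess e f)) (BNot (NLess f e)))"

lemma bval_neq_exp [simp]: "bval (neq_exp e f) s \<longleftrightarrow> nval e s \<noteq> nval f s"
  by (auto simp: neq_exp_def)

abbreviation or_exp :: "bexp \<Rightarrow> bexp \<Rightarrow> bexp" where
  "or_exp b c \<equiv> BNot (BAnd (BNot b) (BNot c))"

definition true_exp :: bexp where
  "true_exp = NLess (NConst 0) (NConst 1)"

lemma bval_true_exp [simp]: "bval true_exp s"
  by (simp add: true_exp_def)

fun conflict_exp :: "cursor \<Rightarrow> cursor \<Rightarrow> bexp" where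
  "conflict_exp (i, j, a) (k, l, b) =
     BAnd (neq_exp (var i) (var k)) (BNot (neq_exp (var j) (var l)))"

text \<open>The condition shared by both modifications of the optimality framework: an assigned
  argument on a machine attaining the makespan.\<close>

fun critical_exp :: "cursor \<Rightarrow> bexp" where
  "critical_exp (i, j, a) = BAnd (entry ''x'' a)
     (BAnd (BNot (RLess (RGet ''C'' (var i)) (RGet ''M'' (NConst 0))))
           (BNot (RLess (RGet ''M'' (NConst 0)) (RGet ''C'' (var i)))))"

text \<open>The efficiency clause joins the surviving feasibility attacks with the added ones, whose
  target is the critical argument. Cursors are parameters because the counterattack test swaps their
  roles.\<close>

fun attack_exp :: "property \<Rightarrow> cursor \<Rightarrow> cursor \<Rightarrow> bexp" where
  "attack_exp Feasibility c d = conflict_exp c d"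
| "attack_exp Efficiency (i, j, a) (k, l, b) =
     or_exp
       (BAnd (conflict_exp (i, j, a) (k, l, b))
         (BNot (BAnd (critical_exp (i, j, a))
           (RLess (RPlus (RGet ''C'' (var k)) (RGet ''p'' (var j))) (RGet ''C'' (var i))))))
       (BAnd (BAnd (critical_exp (k, l, b)) (entry ''x'' a))
       (BAnd (BAnd (neq_exp (var i) (var k)) (neq_exp (var j) (var l)))
       (BAnd (RLess (RGet ''p'' (var j)) (RGet ''p'' (var l)))
         (RLess (RPlus (RGet ''C'' (var i)) (RGet ''p'' (var l)))
                (RPlus (RGet ''C'' (var k)) (RGet ''p'' (var j)))))))"
| "attack_exp Decisions (i, j, a) (k, l, b) =
     BAnd (or_exp (conflict_exp (i, j, a) (k, l, b))
       (BAnd (BNot (neq_exp (var i) (var k)))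
       (BAnd (BNot (neq_exp (var j) (var l))) (entry ''neg'' a))))
     (BNot (entry ''pos'' b))"

lemma bval_entry:
  assumes "env I S D s" "points I (i, j, a) u s" "u \<in> machines I \<times> jobs I"
  shows "bval (entry ''x'' a) s \<longleftrightarrow> S (fst u) (snd u) \<noteq> 0"
    and "bval (entry ''neg'' a) s \<longleftrightarrow> u \<in> fst D"
    and "bval (entry ''pos'' a) s \<longleftrightarrow> u \<in> snd D"
  using assms is_input_entries[of I S D s "fst u" "snd u"] by (auto simp: env_def)

lemma bval_conflict_exp:
  assumes "points I c u s" "points I d v s"
    "u \<in> machines I \<times> jobs I" "v \<in> machines I \<times> jobs I"
  shows "bval (conflict_exp c d) s \<longleftrightarrow> (u, v) \<in> attacks (feasibility_af I)"
  using assms by (cases c; cases d; cases u; cases v) auto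

lemma bval_critical_exp:
  assumes "env I S D s" "points I c u s" "u \<in> machines I \<times> jobs I"
  shows "bval (critical_exp c) s \<longleftrightarrow>
    S (fst u) (snd u) \<noteq> 0 \<and> completion I S (fst u) = makespan I S"
proof -
  obtain i j a where c: "c = (i, j, a)"
    by (cases c)
  show ?thesis
    using assms bval_entry(1)[of I S D s i j a u] by (auto simp: c env_def)
qed

lemma bval_attack_exp:
  assumes sched: "is_schedule I S" and decs: "fixed_decisions I D"
    and s: "env I S D s" and c: "points I c u s" and d: "points I d v s"
    and u: "u \<in> machines I \<times> jobs I" and v: "v \<in> machines I \<times> jobs I"
  shows "bval (attack_exp p c d) s \<longleftrightarrow> (u, v) \<in> attacks (framework p I S D)"
proof -
  obtain i j a where c': "c = (i, j, a)"
    by (cases c)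
  obtain k l b where d': "d = (k, l, b)"
    by (cases d)
  obtain ui uj where u': "u = (ui, uj)" "ui \<in> machines I" "uj \<in> jobs I"
    using u by blast
  obtain vi vj where v': "v = (vi, vj)" "vi \<in> machines I" "vj \<in> jobs I"
    using v by blast
  \<comment> \<open>The program tests entries for being non-zero, the frameworks for being 1; a
    schedule makes these agree.\<close>
  have one: "S i j \<noteq> 0 \<longleftrightarrow> S i j = 1" if "i \<in> machines I" "j \<in> jobs I" for i j
    using sched that by (fastforce simp: is_schedule_def)
  note entries = bval_entry[OF s c[unfolded c'] u] bval_entry[OF s d[unfolded d'] v]
  note conflict = bval_conflict_exp[OF c d u v]
  note critical = bval_critical_exp[OF s c u] bval_critical_exp[OF s d v]
  have nums: "nats s i 0 = ui" "nats s j 0 = uj" "nats s k 0 = vi" "nats s l 0 = vj"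
    using c d by (simp_all add: c' d' u' v')
  have reals: "reals s ''C'' ui = completion I S ui" "reals s ''C'' vi = completion I S vi"
    "reals s ''p'' uj = ptime I uj" "reals s ''p'' vj = ptime I vj"
    using s u' v' by (simp_all add: env_def is_input_def)
  show ?thesis
  proof (cases p)
    case Feasibility
    then show ?thesis
      using conflict by simp
  next
    case Efficiency
    \<comment> \<open>The expression is opened only down to its conflict, critical, entry and
      comparison tests, whose meanings are quoted; the rest is propositional.\<close>
    have "bval (attack_exp p c d) s \<longleftrightarrow>
        ((u, v) \<in> attacks (feasibility_af I) \<and>
          \<not> ((S ui uj \<noteq> 0 \<and> completion I S ui = makespan I S) \<and>
             completion I S vi + ptime I uj < completion I S ui)) \<or>
        ((S vi vj \<noteq> 0 \<and> completion I S vi = makespan I S) \<and> S ui uj \<noteq> 0) \<and>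
        (ui \<noteq> vi \<and> uj \<noteq> vj) \<and> ptime I uj < ptime I vj \<and>
        completion I S ui + ptime I vj < completion I S vi + ptime I uj"
      by (simp only: Efficiency c' d' attack_exp.simps bval.simps(2-4) rval.simps nval.simps
          bval_neq_exp entries(1) conflict[unfolded c' d'] critical[unfolded c' d'] nums reals
          u'(1) v'(1) fst_conv snd_conv de_Morgan_conj not_not) argo
    also have "\<dots> \<longleftrightarrow> (u, v) \<in> attacks (framework p I S D)"
      unfolding Efficiency framework.simps u'(1) v'(1) in_attacks_feasibility in_attacks_optimality
        one[OF u'(2,3)] one[OF v'(2,3)]
      using u'(2,3) v'(2,3) by argo
    finally show ?thesis .
  next
    case Decisions
    have "bval (attack_exp p c d) s \<longleftrightarrow>
        ((u, v) \<in> attacks (feasibility_af I) \<or> ui = vi \<and> uj = vj \<and> u \<in> fst D) \<and> v \<notin> snd D"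
      using entries(2,6) conflict nums
      by (auto simp: Decisions c' d' simp del: conflict_exp.simps in_attacks_feasibility)
    also have "\<dots> \<longleftrightarrow> (u, v) \<in> attacks (framework p I S D)"
      unfolding Decisions framework.simps u'(1) v'(1) in_attacks_feasibility
        in_attacks_fixed_decision[OF decs]
      using u'(2,3) v'(2,3) by blast
    finally show ?thesis .
  qed
qed

section \<open>Tests for the three kinds of explanation\<close>

definition attack_test :: "property \<Rightarrow> bexp" where
  "attack_test p = BAnd (BAnd (entry ''x'' ''a'') (entry ''x'' ''b''))
     (BAnd (attack_exp p inner outer)
       (if p = Feasibility then true_exp else BNot (conflict_exp inner outer)))"

text \<open>For fixed decisions the target must be unattacked altogether, so sources outside
  \<open>E\<close> count as well.\<close>

definition bad_test :: "property \<Rightarrow> bexp" where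
  "bad_test p = BAnd (if p = Decisions then true_exp else entry ''x'' ''a'') (attack_exp p inner outer)"

text \<open>Only efficiency asks for a counterattack, hence the swapped cursors. For the other
  properties \<open>true_exp\<close> raises the flag at any source.\<close>

definition good_test :: "property \<Rightarrow> bexp" where
  "good_test p =
     (if p = Efficiency then BAnd (entry ''x'' ''a'') (attack_exp p outer inner) else true_exp)"

lemma decides_tests:
  assumes "is_schedule I S" "fixed_decisions I D"
  shows "decides I S D (attack_test p) (\<lambda>u v. S (fst u) (snd u) \<noteq> 0 \<and> S (fst v) (snd v) \<noteq> 0 \<and>
      (u, v) \<in> attacks (framework p I S D) \<and>
      (p \<noteq> Feasibility \<longrightarrow> (u, v) \<notin> attacks (feasibility_af I)))"
    and "decides I S D (bad_test p) (\<lambda>u v. (p \<noteq> Decisions \<longrightarrow> S (fst u) (snd u) \<noteq> 0) \<and>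
      (u, v) \<in> attacks (framework p I S D))"
    and "decides I S D (good_test p) (\<lambda>u v. p = Efficiency \<longrightarrow>
      S (fst u) (snd u) \<noteq> 0 \<and> (v, u) \<in> attacks (framework p I S D))"
  unfolding decides_def attack_test_def bad_test_def good_test_def
  by (auto simp: bval_attack_exp[OF assms] bval_conflict_exp bval_entry
      simp del: conflict_exp.simps attack_exp.simps points.simps bval.simps(1))

lemma explains_Attack_iff:
  assumes "is_schedule I S" "corresponds I S E"
  shows "explains p (framework p I S D) I S D E (Attack u v) \<longleftrightarrow>
    u \<in> machines I \<times> jobs I \<and> v \<in> machines I \<times> jobs I \<and>
    S (fst u) (snd u) \<noteq> 0 \<and> S (fst v) (snd v) \<noteq> 0 \<and>
    (u, v) \<in> attacks (framework p I S D) \<and>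
    (p \<noteq> Feasibility \<longrightarrow> (u, v) \<notin> attacks (feasibility_af I))"
proof -
  have "u \<in> E \<longleftrightarrow> u \<in> machines I \<times> jobs I \<and> S (fst u) (snd u) \<noteq> 0" for u
    using assms by (cases u) (fastforce simp: corresponds_iff[OF assms(2)] is_schedule_def)
  then show ?thesis
    by (cases p) auto
qed

lemma explains_NonAttack_iff:
  assumes inst: "makespan_instance I" and sched: "is_schedule I S" and corr: "corresponds I S E"
  defines "cells \<equiv> machines I \<times> jobs I"
  shows "explains p (framework p I S D) I S D E (NonAttack E' v) \<longleftrightarrow>
    E' = E \<and> v \<in> cells \<and> S (fst v) (snd v) = 0 \<and>
    (\<forall>u\<in>cells. \<not> ((p \<noteq> Decisions \<longrightarrow> S (fst u) (snd u) \<noteq> 0) \<and>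
       (u, v) \<in> attacks (framework p I S D))) \<and>
    (\<exists>u\<in>cells. p = Efficiency \<longrightarrow>
       S (fst u) (snd u) \<noteq> 0 \<and> (v, u) \<in> attacks (framework p I S D))"
proof -
  have E: "u \<in> E \<longleftrightarrow> u \<in> cells \<and> S (fst u) (snd u) \<noteq> 0" for u
    using sched by (cases u) (fastforce simp: corresponds_iff[OF corr] is_schedule_def cells_def)
  \<comment> \<open>Outside efficiency the existential over \<open>cells\<close> has a vacuous body
    and only requires some entry to exist.\<close>
  have "(1, 1) \<in> cells"
    using inst by (simp add: cells_def makespan_instance_def machines_def jobs_def)
  then have "\<exists>u. u \<in> cells" ..
  moreover have "args (feasibility_af I) = cells" "args (optimality_af I S) = cells"
    "args (fixed_decision_af I D) = cells"
    by (simp_all add: cells_def)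
  moreover have "(\<forall>u\<in>E. P u) \<longleftrightarrow> (\<forall>u\<in>cells. S (fst u) (snd u) \<noteq> 0 \<longrightarrow> P u)"
    "(\<exists>u\<in>E. P u) \<longleftrightarrow> (\<exists>u\<in>cells. S (fst u) (snd u) \<noteq> 0 \<and> P u)" for P
    using E by blast+
  ultimately show ?thesis
    by (cases p) (auto simp: E simp del: args_simps split_paired_All split_paired_Ex)
qed

text \<open>Both \<open>prog\<close> and \<open>c\<close> are built from \<open>p\<close> alone, so
  one program and one constant serve all instances.\<close>

lemma exec_search:
  fixes p :: property
  assumes inst: "makespan_instance I" and sched: "is_schedule I S" and decs: "fixed_decisions I D"
    and corr: "corresponds I S E" and input: "is_input I S D s"
  defines "prog \<equiv> Seq preprocess (search (attack_test p) (bad_test p) (good_test p))"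
    and "c \<equiv> com_cost (test_pair (attack_test p) (bad_test p) (good_test p)) + com_cost conclude + 500"
  shows "\<exists>t s'. exec prog s t s' \<and> t \<le> c * (num_jobs I ^ 2 * num_machines I ^ 2) \<and>
    output_explanations E s' = {e. explains p (framework p I S D) I S D E e}"
proof -
  let ?X = "num_machines I * num_jobs I"
  let ?T = "com_cost (test_pair (attack_test p) (bad_test p) (good_test p)) + com_cost conclude + 200"
  \<comment> \<open>This absorbs the linear preprocessing; the 500 in \<open>c\<close> is 300 for it
    plus 200 for the search.\<close>
  have "?X \<le> ?X ^ 2"
    by (simp add: power2_eq_square)
  then have time: "?X * 300 + ?X ^ 2 * ?T \<le> c * (num_jobs I ^ 2 * num_machines I ^ 2)"
    by (simp add: c_def algebra_simps power_mult_distrib)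
  have out: "output_explanations E s' = {e. explains p (framework p I S D) I S D E e}"
    if "recorded_attacks s' = {(u, v). u \<in> machines I \<times> jobs I \<and> v \<in> machines I \<times> jobs I \<and>
        (S (fst u) (snd u) \<noteq> 0 \<and> S (fst v) (snd v) \<noteq> 0 \<and>
          (u, v) \<in> attacks (framework p I S D) \<and>
          (p \<noteq> Feasibility \<longrightarrow> (u, v) \<notin> attacks (feasibility_af I)))} \<and>
      recorded_nonattacks s' = {v \<in> machines I \<times> jobs I. S (fst v) (snd v) = 0 \<and>
        (\<forall>u\<in>machines I \<times> jobs I. \<not> ((p \<noteq> Decisions \<longrightarrow> S (fst u) (snd u) \<noteq> 0) \<and>
          (u, v) \<in> attacks (framework p I S D))) \<and>
        (\<exists>u\<in>machines I \<times> jobs I. p = Efficiency \<longrightarrow>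
          S (fst u) (snd u) \<noteq> 0 \<and> (v, u) \<in> attacks (framework p I S D))}" for s'
  proof -
    have attacks: "(u, v) \<in> recorded_attacks s' \<longleftrightarrow>
        explains p (framework p I S D) I S D E (Attack u v)" for u v
      by (simp only: explains_Attack_iff[OF sched corr] conjunct1[OF that]
          mem_Collect_eq case_prod_conv conj_assoc)
    have nonattacks: "E' = E \<and> v \<in> recorded_nonattacks s' \<longleftrightarrow>
        explains p (framework p I S D) I S D E (NonAttack E' v)" for E' v
      by (simp only: explains_NonAttack_iff[OF inst sched corr] conjunct2[OF that]
          mem_Collect_eq conj_assoc)
    have "e \<in> output_explanations E s' \<longleftrightarrow> explains p (framework p I S D) I S D E e" for e
    proof (cases e)
      case (Attack u v)
      with attacks show ?thesis
        by (simp add: output_explanations_eq del: explains.simps split_paired_Ex)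
    next
      case (NonAttack E' v)
      with nonattacks[of E' v] show ?thesis
        by (auto simp: output_explanations_eq simp del: explains.simps split_paired_Ex)
    qed
    then show ?thesis
      by blast
  qed
  have "runs prog s (?X * 300 + ?X ^ 2 * ?T)
    (\<lambda>s'. output_explanations E s' = {e. explains p (framework p I S D) I S D E e})"
    unfolding prog_def
    by (rule runs_Seq[OF runs_preprocess[OF inst sched input]],
        rule runs_mono[OF runs_search[OF inst decides_tests[OF sched decs]] order_refl out])
  with time show ?thesis
    unfolding runs_def by (meson le_trans)
qed

theorem theorem4:
  shows
    "(\<forall>I S D E. makespan_instance I \<and> is_schedule I S \<and> fixed_decisions I D \<and> corresponds I S E \<longrightarrow>
        (fails Feasibility I S D \<longleftrightarrow> explained Feasibility I S D E) \<and>
        (feasible I S \<longrightarrow> (fails Efficiency I S D \<longleftrightarrow> explained Efficiency I S D E)) \<and>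
        (fails Efficiency I S D \<longleftrightarrow>
           explained Feasibility I S D E \<or> explained Efficiency I S D E) \<and>
        (2 \<le> num_machines I \<or> feasible I S \<longrightarrow>
           (fails Decisions I S D \<longleftrightarrow> explained Decisions I S D E)) \<and>
        (fails Decisions I S D \<longrightarrow> explained Decisions I S D E)) \<and>
     (\<forall>p. \<exists>prog c. \<forall>I S D E s.
        makespan_instance I \<and> is_schedule I S \<and> fixed_decisions I D \<and> corresponds I S E \<and>
        is_input I S D s \<longrightarrow>
        (\<exists>t s'. exec prog s t s' \<and>
           t \<le> c * (num_jobs I ^ 2 * num_machines I ^ 2) \<and>
           output_explanations E s' = {e. explains p (framework p I S D) I S D E e})) \<and>
     (\<exists>q :: nat poly. \<forall>p I S D E e.
        makespan_instance I \<and> is_schedule I S \<and> fixed_decisions I D \<and> corresponds I S E \<and>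
        explains p (framework p I S D) I S D E e \<longrightarrow>
        explanation_size e \<le> poly q (schedule_size I))"
proof (intro conjI)
  show "\<forall>I S D E. makespan_instance I \<and> is_schedule I S \<and> fixed_decisions I D \<and> corresponds I S E \<longrightarrow>
      (fails Feasibility I S D \<longleftrightarrow> explained Feasibility I S D E) \<and>
      (feasible I S \<longrightarrow> (fails Efficiency I S D \<longleftrightarrow> explained Efficiency I S D E)) \<and>
      (fails Efficiency I S D \<longleftrightarrow>
         explained Feasibility I S D E \<or> explained Efficiency I S D E) \<and>
      (2 \<le> num_machines I \<or> feasible I S \<longrightarrow>
         (fails Decisions I S D \<longleftrightarrow> explained Decisions I S D E)) \<and>
      (fails Decisions I S D \<longrightarrow> explained Decisions I S D E)"
  proof (intro allI impI, elim conjE)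
    fix I S D E
    assume I: "makespan_instance I" "is_schedule I S" "fixed_decisions I D" "corresponds I S E"
    note feas = infeasible_iff_explained[OF I]
    have eff: "fails Efficiency I S D \<longleftrightarrow> explained Efficiency I S D E" if "feasible I S"
      using that by (rule inefficient_iff_explained[OF I])
    \<comment> \<open>An infeasible schedule makes both sides true; a feasible one rules out the
      first disjunct.\<close>
    moreover have "fails Efficiency I S D \<longleftrightarrow>
        explained Feasibility I S D E \<or> explained Efficiency I S D E"
      using feas eff by (cases "feasible I S") (simp_all add: efficient_def)
    ultimately show "(fails Feasibility I S D \<longleftrightarrow> explained Feasibility I S D E) \<and>
      (feasible I S \<longrightarrow> (fails Efficiency I S D \<longleftrightarrow> explained Efficiency I S D E)) \<and>
      (fails Efficiency I S D \<longleftrightarrow>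
         explained Feasibility I S D E \<or> explained Efficiency I S D E) \<and>
      (2 \<le> num_machines I \<or> feasible I S \<longrightarrow>
         (fails Decisions I S D \<longleftrightarrow> explained Decisions I S D E)) \<and>
      (fails Decisions I S D \<longrightarrow> explained Decisions I S D E)"
      using feas violation_explained[OF I] explained_violation[OF I] by blast
  qed
next
  show "\<forall>p. \<exists>prog c. \<forall>I S D E s.
      makespan_instance I \<and> is_schedule I S \<and> fixed_decisions I D \<and> corresponds I S E \<and>
      is_input I S D s \<longrightarrow>
      (\<exists>t s'. exec prog s t s' \<and>
         t \<le> c * (num_jobs I ^ 2 * num_machines I ^ 2) \<and>
         output_explanations E s' = {e. explains p (framework p I S D) I S D E e})"
    using exec_search by blast
next
  have "explanation_size e \<le> poly [:0, 4, 2:] (schedule_size I)"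
    if "corresponds I S E" "explains p (framework p I S D) I S D E e" for p I S D E e
    using explanation_size_le[OF that] by (simp add: algebra_simps)
  then show "\<exists>q :: nat poly. \<forall>p I S D E e.
      makespan_instance I \<and> is_schedule I S \<and> fixed_decisions I D \<and> corresponds I S E \<and>
      explains p (framework p I S D) I S D E e \<longrightarrow>
      explanation_size e \<le> poly q (schedule_size I)"
    by blast
qed

end
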